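(* Let $x^*$ be the center of $\mathrm{MaxIE}(P)$. There exist an open neighborhood $U_{\mathrm{PL}}\subseteq U_{\mathrm{QG}}\cap U_{\mathrm{shift}}$ of $x^*$ and $\sigma>0$ such that $$v(x)-v(x^* )\le\frac{\beta n(n+1)^2}{2\sigma\mu^2}\,\tau(x),\qquad\forall x\in U_{\mathrm{PL}}.$$
   Context: $P=\{x\in\mathbb R^n: a_i^\top x\le 1,\ i=1,\dots,m\}$ is a full-dimensional (bounded) polytope. For $c\in\mathbb R^n$ and $Q$ symmetric positive definite, $\mathcal E(c,Q)=\{y\in\mathbb R^n:(y-c)^\top Q(y-c)\le 1\}$, with normalized volume $\mathrm{Vol}(\mathcal E(c,Q))=\det(Q)^{-1/2}$. The polar of $S$ is $S^\circ=\{y: y^\top s\le1\ \forall s\in S\}$. $\mathrm{MinCE}(K)$ is the unique minimum-volume ellipsoid containing a full-dimensional compact set $K$; $\mathrm{MaxIE}(P)$ is the unique maximum-volume ellipsoid contained in $P$. For $x\in\mathrm{int}(P)$ write $\tilde a_i(x)=a_i/(1-a_i^\top x)$, $\mathrm{MinCE}((P-x)^\circ)=\mathcal E(c(x),Q(x))$, $\tau(x)=c(x)^\top Q(x)c(x)$, $v(x)=\log\mathrm{Vol}(\mathrm{MinCE}((P-x)^\circ))$. Fixed data (which exist): an open ball $U_{\mathrm{QG}}\subseteq\mathrm{int}(P)$ around $x^*$ and $\mu>0$ with $v(x)-v(x^* )\ge\mu\|x-x^*\|^2$ on $U_{\mathrm{QG}}$; an open neighborhood $U_{\mathrm{shift}}\subseteq\mathrm{int}(P)$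 of $x^*$ and $\beta>0$ such that, with $\bar c(x)=Q(x^* )^{-1}(x-x^* )$, $(\tilde a_i(x)-\bar c(x))^\top Q(x^* )(\tilde a_i(x)-\bar c(x))\le1+\beta\|x-x^*\|^2$ for all $i\in[m]$ and $x\in U_{\mathrm{shift}}$, so that the ellipsoid $\mathcal E\bigl(\bar c(x),Q(x^* )/(1+\beta\|x-x^*\|^2)\bigr)$ contains $(P-x)^\circ$ for $x\in U_{\mathrm{shift}}$. *)

theory Defs
  imports "HOL-Analysis.Analysis"
begin

definition polytope_ineq :: "nat \<Rightarrow> (nat \<Rightarrow> real ^ 'n) \<Rightarrow> (real ^ 'n) set" where
  "polytope_ineq m a = {x. \<forall>i\<in>{1..m}. a i \<bullet> x \<le> 1}"

definition sym_pos_def :: "real ^ 'n ^ 'n \<Rightarrow> bool" where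
  "sym_pos_def Q \<longleftrightarrow> transpose Q = Q \<and> (\<forall>y. y \<noteq> 0 \<longrightarrow> y \<bullet> (Q *v y) > 0)"

definition ellipsoid :: "real ^ 'n \<Rightarrow> real ^ 'n ^ 'n \<Rightarrow> (real ^ 'n) set" where
  "ellipsoid c Q = {y. (y - c) \<bullet> (Q *v (y - c)) \<le> 1}"

text \<open>The volume of \<open>ellipsoid c Q\<close>, normalized so that the unit ball has volume 1.\<close>

definition ellipsoid_vol :: "real ^ 'n ^ 'n \<Rightarrow> real" where
  "ellipsoid_vol Q = det Q powr (- 1 / 2)"

definition polar_set :: "(real ^ 'n) set \<Rightarrow> (real ^ 'n) set" where
  "polar_set S = {y. \<forall>s\<in>S. y \<bullet> s \<le> 1}"

text \<open>An ellipsoid is represented by its center and its matrix, both of which it determines;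
  uniqueness of the extremal ellipsoids is therefore uniqueness of the pair \<open>(c, Q)\<close>.\<close>

definition is_min_CE :: "(real ^ 'n) set \<Rightarrow> real ^ 'n \<Rightarrow> real ^ 'n ^ 'n \<Rightarrow> bool" where
  "is_min_CE K c Q \<longleftrightarrow> sym_pos_def Q \<and> K \<subseteq> ellipsoid c Q \<and>
     (\<forall>c' Q'. sym_pos_def Q' \<and> K \<subseteq> ellipsoid c' Q' \<longrightarrow> ellipsoid_vol Q \<le> ellipsoid_vol Q')"

definition is_max_IE :: "(real ^ 'n) set \<Rightarrow> real ^ 'n \<Rightarrow> real ^ 'n ^ 'n \<Rightarrow> bool" where
  "is_max_IE K c Q \<longleftrightarrow> sym_pos_def Q \<and> ellipsoid c Q \<subseteq> K \<and>
     (\<forall>c' Q'. sym_pos_def Q' \<and> ellipsoid c' Q' \<subseteq> K \<longrightarrow> ellipsoid_vol Q' \<le> ellipsoid_vol Q)"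

definition min_CE :: "(real ^ 'n) set \<Rightarrow> (real ^ 'n) \<times> (real ^ 'n ^ 'n)" where
  "min_CE K = (THE (c, Q). is_min_CE K c Q)"

definition max_IE :: "(real ^ 'n) set \<Rightarrow> (real ^ 'n) \<times> (real ^ 'n ^ 'n)" where
  "max_IE K = (THE (c, Q). is_max_IE K c Q)"

definition polar_at :: "(real ^ 'n) set \<Rightarrow> real ^ 'n \<Rightarrow> (real ^ 'n) set" where
  "polar_at P x = polar_set ((\<lambda>y. y - x) ` P)"

definition cpol :: "(real ^ 'n) set \<Rightarrow> real ^ 'n \<Rightarrow> real ^ 'n" where
  "cpol P x = fst (min_CE (polar_at P x))"

definition Qpol :: "(real ^ 'n) set \<Rightarrow> real ^ 'n \<Rightarrow> real ^ 'n ^ 'n" where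
  "Qpol P x = snd (min_CE (polar_at P x))"

definition tau :: "(real ^ 'n) set \<Rightarrow> real ^ 'n \<Rightarrow> real" where
  "tau P x = cpol P x \<bullet> (Qpol P x *v cpol P x)"

definition vpol :: "(real ^ 'n) set \<Rightarrow> real ^ 'n \<Rightarrow> real" where
  "vpol P x = ln (ellipsoid_vol (Qpol P x))"

definition a_tilde :: "(nat \<Rightarrow> real ^ 'n) \<Rightarrow> nat \<Rightarrow> real ^ 'n \<Rightarrow> real ^ 'n" where
  "a_tilde a i x = (1 / (1 - a i \<bullet> x)) *\<^sub>R a i"

definition c_bar :: "(real ^ 'n) set \<Rightarrow> real ^ 'n \<Rightarrow> real ^ 'n \<Rightarrow> real ^ 'n" where
  "c_bar P xs x = matrix_inv (Qpol P xs) *v (x - xs)"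

end

theory Submission
  imports Defs
begin

text \<open>
  Let \<open>d = x - x\<^sup>*\<close>. The key inequality is \<open>v(x) - v(x\<^sup>*) \<le> (n + 1) c(x) \<bullet> d\<close>. Together with quadratic
  growth and Cauchy--Schwarz it gives \<open>\<mu> \<bar>d\<bar> \<le> (n + 1) \<bar>c(x)\<bar>\<close>; the shifted ellipsoid gives
  \<open>v(x) - v(x\<^sup>*) \<le> (n \<beta> / 2) \<bar>d\<bar>\<^sup>2\<close>; and \<open>\<sigma>\<close> is a lower bound for the eigenvalues of \<open>Q(x)\<close>, uniform
  since \<open>(P - x)\<^sup>\<circ>\<close> contains a fixed ball while \<open>v\<close> is bounded above near \<open>x\<^sup>*\<close>.

  For the key inequality, homogenize: the minimal ellipsoid of the points \<open>p\<^sub>i\<close> corresponds to the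
  form \<open>H\<close> of maximal determinant on \<open>\<real>\<^sup>n\<^sup>+\<^sup>1\<close> with \<open>H \<le> n + 1\<close> at all \<open>(1, p\<^sub>i)\<close>. The vertices of the polar at
  \<open>x\<^sup>*\<close> are \<open>p\<^sub>i / s\<^sub>i\<close> with \<open>s\<^sub>i = 1 + p\<^sub>i \<bullet> d\<close>, a projective image of those at \<open>x\<close>, so the optimal form at \<open>x\<^sup>*\<close>
  pulls back, with the same determinant, to a form \<open>H'\<close> with \<open>H' \<le> (n + 1) s\<^sub>i\<^sup>2\<close> at \<open>(1, p\<^sub>i)\<close>.
  Concavity of the logarithm, applied in a basis diagonalizing both \<open>H\<close> and \<open>H'\<close>, turns this into a
  bound linear in \<open>p\<^sub>i\<close> on the direction \<open>ln (H\<^sup>-\<^sup>1 H')\<close> at the contact points, and first-order optimality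
  of \<open>H\<close> bounds the trace of that direction, which is \<open>ln (det H' / det H)\<close>.
\<close>

subsection \<open>Simultaneous diagonalization and determinants\<close>

lemma symmetric_dot: fixes B :: "real^'m^'m"
  assumes "transpose B = B" shows "x \<bullet> (B *v y) = y \<bullet> (B *v x)"
  by (metis assms dot_lmul_matrix inner_commute vector_transpose_matrix)

text \<open>First-variation argument in one dimension: \<open>K\<close> exceeds \<bar>c\<bar>, so
  for nonzero \<open>b\<close> the linear term outweighs the quadratic one at
  \<open>t = - b / K\<close> and the value is negative.\<close>

lemma nonneg_quadratic_no_linear_term:
  fixes b c :: real
  assumes "\<And>t. 0 \<le> 2 * b * t + c * t\<^sup>2"
  shows "b = 0"
proof (rule ccontr)
  assume b: "b \<noteq> 0"
  define K where "K = \<bar>c\<bar> + 1"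
  have K: "K > 0" "c < 2 * K" by (auto simp: K_def)
  have "0 \<le> 2 * b * (- b / K) + c * (- b / K)\<^sup>2" using assms .
  also have "\<dots> = (b\<^sup>2 / K) * (c / K - 2)"
    using K by (simp add: power2_eq_square field_simps)
  also have "\<dots> < 0"
    using b K by (intro mult_pos_neg) (auto simp: field_simps)
  finally show False by simp
qed

lemma quadratic_form_add: fixes B :: "real^'m^'m"
  assumes "transpose B = B"
  shows "(u + t *\<^sub>R w) \<bullet> (B *v (u + t *\<^sub>R w)) = u \<bullet> (B *v u) + 2 * t * (u \<bullet> (B *v w)) + t\<^sup>2 * (w \<bullet> (B *v w))"
  using symmetric_dot[OF assms, of w u]
  by (simp add: matrix_vector_right_distrib inner_add_left inner_add_right
     matrix_vector_mult_scaleR algebra_simps power2_eq_square)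

text \<open>Each new vector maximizes the Rayleigh quotient of \<open>B\<close> against \<open>A\<close> on the
  \<open>A\<close>-orthogonal complement of the previous ones.\<close>

lemma simultaneous_orthogonal_family:
  fixes A B :: "real^'m^'m"
  assumes A: "sym_pos_def A" and B: "transpose B = B" and "finite I"
  shows "\<exists>v::'m \<Rightarrow> real^'m. (\<forall>i\<in>I. \<forall>j\<in>I. v i \<bullet> (A *v v j) = (if i = j then 1 else 0)) \<and>
    (\<forall>i\<in>I. \<forall>j\<in>I. i \<noteq> j \<longrightarrow> v i \<bullet> (B *v v j) = 0) \<and>
    (\<forall>w. (\<forall>j\<in>I. v j \<bullet> (A *v w) = 0) \<longrightarrow> (\<forall>j\<in>I. v j \<bullet> (B *v w) = 0))"
  using \<open>finite I\<close>
proof induction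
  case empty then show ?case by simp
next
  case (insert k F)
  from insert.IH obtain v :: "'m \<Rightarrow> real^'m" where
    V: "(\<forall>i\<in>F. \<forall>j\<in>F. v i \<bullet> (A *v v j) = (if i = j then 1 else 0)) \<and>
      (\<forall>i\<in>F. \<forall>j\<in>F. i \<noteq> j \<longrightarrow> v i \<bullet> (B *v v j) = 0) \<and>
      (\<forall>w. (\<forall>j\<in>F. v j \<bullet> (A *v w) = 0) \<longrightarrow> (\<forall>j\<in>F. v j \<bullet> (B *v w) = 0))" ..
  have vA: "v i \<bullet> (A *v v j) = (if i = j then 1 else 0)" if "i \<in> F" "j \<in> F" for i j
    using V that by simp
  have vB: "v i \<bullet> (B *v v j) = 0" if "i \<in> F" "j \<in> F" "i \<noteq> j" for i j
    using V that by simp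
  \<comment> \<open>This clause carries the induction: on the \<open>A\<close>-complement of the
    family the mixed \<open>B\<close>-terms vanish, so the next vector is automatically
    \<open>B\<close>-orthogonal to the old ones.\<close>
  have vw: "v j \<bullet> (B *v w) = 0" if "\<forall>j\<in>F. v j \<bullet> (A *v w) = 0" "j \<in> F" for w j
    using V that by simp
  have Asym: "transpose A = A" and Apos: "\<And>y. y \<noteq> 0 \<Longrightarrow> y \<bullet> (A *v y) > 0"
    using A by (auto simp: sym_pos_def_def)
  define S where "S = {w. \<forall>j\<in>F. v j \<bullet> (A *v w) = 0}"
  have S_add: "u + t *\<^sub>R w \<in> S" if "u \<in> S" "w \<in> S" for u w t
    using that by (simp add: S_def matrix_vector_right_distrib inner_add_right matrix_vector_mult_scaleR)
  have S_scale: "t *\<^sub>R w \<in> S" if "w \<in> S" for w t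
    using that by (simp add: S_def matrix_vector_mult_scaleR)
  \<comment> \<open>Since \<open>k\<close> lies outside \<open>F\<close>, the vectors
    \<open>A *v v j\<close> are too few to span the space.\<close>
  obtain w0 where w0: "w0 \<noteq> 0" "w0 \<in> S"
  proof -
    have "dim ((\<lambda>j. A *v v j) ` F) \<le> card ((\<lambda>j. A *v v j) ` F)"
      by (intro dim_le_card') (use insert in auto)
    also have "\<dots> \<le> card F" by (rule card_image_le) (use insert in auto)
    also have "\<dots> < card (UNIV :: 'm set)"
      by (rule psubset_card_mono) (use insert in auto)
    finally have "dim ((\<lambda>j. A *v v j) ` F) < DIM(real^'m)" by simp
    then obtain x where x: "x \<noteq> 0" "\<And>y. y \<in> span ((\<lambda>j. A *v v j) ` F) \<Longrightarrow> orthogonal x y"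
      by (rule orthogonal_to_subspace_exists) auto
    have "x \<bullet> (A *v v j) = 0" if "j \<in> F" for j
      using x(2)[of "A *v v j"] that by (auto simp: orthogonal_def intro: span_base)
    then show ?thesis using x(1) that symmetric_dot[OF Asym, of x] by (auto simp: S_def)
  qed
  have contq: "continuous_on T (\<lambda>w. w \<bullet> (M *v w))" for T and M :: "real^'m^'m"
    by (intro continuous_intros linear_continuous_on matrix_vector_mul_bounded_linear)
  have "closed S"
  proof -
    have "S = (\<Inter>j\<in>F. {w. v j \<bullet> (A *v w) = 0})" by (auto simp: S_def)
    moreover have "closed {w. v j \<bullet> (A *v w) = 0}" for j
      by (intro closed_Collect_eq continuous_intros linear_continuous_on matrix_vector_mul_bounded_linear)
    ultimately show ?thesis by auto
  qed
  then have comp: "compact (sphere 0 1 \<inter> S)" by (intro compact_Int_closed) auto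
  have mem: "(1 / norm w0) *\<^sub>R w0 \<in> sphere 0 1 \<inter> S" using w0 S_scale by auto
  have Anz: "w \<bullet> (A *v w) \<noteq> 0" if "w \<in> sphere 0 1 \<inter> S" for w
    using Apos[of w] that by (cases "w = 0") auto
  have cont: "continuous_on (sphere 0 1 \<inter> S) (\<lambda>w. (w \<bullet> (B *v w)) / (w \<bullet> (A *v w)))"
    by (intro continuous_on_divide contq ballI Anz)
  obtain u where u: "u \<in> sphere 0 1 \<inter> S" "\<forall>w\<in>sphere 0 1 \<inter> S.
      (w \<bullet> (B *v w)) / (w \<bullet> (A *v w)) \<le> (u \<bullet> (B *v u)) / (u \<bullet> (A *v u))"
    using continuous_attains_sup[OF comp _ cont] mem by (metis (lifting) empty_iff)
  define r where "r = (u \<bullet> (B *v u)) / (u \<bullet> (A *v u))"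
  have upos: "u \<bullet> (A *v u) > 0" using u(1) Apos[of u] by (cases "u = 0") auto
  have uu: "u \<bullet> (B *v u) = r * (u \<bullet> (A *v u))" using upos by (simp add: r_def)
  have le: "w \<bullet> (B *v w) \<le> r * (w \<bullet> (A *v w))" if "w \<in> S" for w
  proof (cases "w = 0")
    case False
    have "(1 / norm w) *\<^sub>R w \<in> sphere 0 1 \<inter> S" using False S_scale that by auto
    from bspec[OF u(2) this] have "(w \<bullet> (B *v w)) / (w \<bullet> (A *v w)) \<le> r"
      using False by (simp add: matrix_vector_mult_scaleR r_def)
    then show ?thesis using Apos[OF False] by (simp add: field_simps)
  qed simp
  \<comment> \<open>On \<open>S\<close> the form \<open>r A - B\<close> is nonnegative and vanishes
    at \<open>u\<close>, so its first variation at \<open>u\<close> along \<open>w\<close> is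
    zero.\<close>
  have uw: "u \<bullet> (B *v w) = r * (u \<bullet> (A *v w))" if "w \<in> S" for w
  proof -
    have "r * (u \<bullet> (A *v w)) - u \<bullet> (B *v w) = 0"
    proof (rule nonneg_quadratic_no_linear_term)
      fix t
      have "u + t *\<^sub>R w \<in> S" using S_add u that by auto
      from le[OF this] show "0 \<le> 2 * (r * (u \<bullet> (A *v w)) - u \<bullet> (B *v w)) * t +
           (r * (w \<bullet> (A *v w)) - w \<bullet> (B *v w)) * t\<^sup>2"
        unfolding quadratic_form_add[OF Asym] quadratic_form_add[OF B] uu
        by (simp add: algebra_simps)
    qed
    then show ?thesis by simp
  qed
  define z where "z = (1 / sqrt (u \<bullet> (A *v u))) *\<^sub>R u"
  have zS: "z \<in> S" using u S_scale by (auto simp: z_def)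
  have zz: "z \<bullet> (A *v z) = 1" using upos by (simp add: z_def matrix_vector_mult_scaleR)
  have zw: "z \<bullet> (B *v w) = r * (z \<bullet> (A *v w))" if "w \<in> S" for w
    using uw[OF that] by (simp add: z_def)
  define v' where "v' = v(k := z)"
  have kF: "k \<notin> F" by fact
  have vz: "v j \<bullet> (A *v z) = 0" "v j \<bullet> (B *v z) = 0" if "j \<in> F" for j
    using zS vw[of z j] that by (simp_all add: S_def)
  have zv: "z \<bullet> (A *v v j) = 0" "z \<bullet> (B *v v j) = 0" if "j \<in> F" for j
    using vz[OF that] symmetric_dot[OF Asym, of z "v j"] symmetric_dot[OF B, of z "v j"] by simp_all
  have v'k: "v' k = z" and v'F: "j \<in> F \<Longrightarrow> v' j = v j" for j using kF by (auto simp: v'_def)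
  show ?case
  proof (intro exI[of _ v'] conjI ballI allI impI)
    fix i j assume "i \<in> insert k F" "j \<in> insert k F"
    then show "v' i \<bullet> (A *v v' j) = (if i = j then 1 else 0)"
      by (cases "i = k"; cases "j = k") (auto simp: v'k v'F vz zv zz vA)
  next
    fix i j assume "i \<in> insert k F" "j \<in> insert k F" "i \<noteq> j"
    then show "v' i \<bullet> (B *v v' j) = 0"
      by (cases "i = k"; cases "j = k") (auto simp: v'k v'F vz zv vB)
  next
    fix w j assume w: "\<forall>j\<in>insert k F. v' j \<bullet> (A *v w) = 0" and j: "j \<in> insert k F"
    then have "w \<in> S" "z \<bullet> (A *v w) = 0" by (auto simp: S_def v'k v'F)
    then show "v' j \<bullet> (B *v w) = 0"
      using zw[of w] vw[of w j] j by (auto simp: S_def v'k v'F)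
  qed
qed

definition diag :: "('m \<Rightarrow> real) \<Rightarrow> real^'m^'m" where
  "diag l = (\<chi> i j. if i = j then l i else 0)"

lemma det_diag: "det (diag l) = (\<Prod>i\<in>UNIV. l i)"
  by (subst det_diagonal) (auto simp: diag_def)

lemma diag_mult_vec: "diag l *v x = (\<chi> i. l i * x $ i)"
  by (simp add: diag_def matrix_vector_mult_def vec_eq_iff if_distrib if_distribR cong: if_cong)

lemma dot_diag: "x \<bullet> (diag l *v x) = (\<Sum>i\<in>UNIV. l i * (x $ i)\<^sup>2)"
  by (simp add: diag_mult_vec inner_vec_def power2_eq_square mult_ac)

lemma diag_1: "diag (\<lambda>_. 1) = mat 1"
  by (simp add: diag_def mat_def)

lemma congruence_entry:
  fixes A L :: "real^'m^'m"
  shows "(transpose L ** A ** L) $ i $ j = column i L \<bullet> (A *v column j L)"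
  by (simp add: matrix_matrix_mult_def matrix_vector_mult_def inner_vec_def column_def transpose_def
      sum_distrib_left sum_distrib_right mult_ac) (subst sum.swap, simp add: mult_ac)

lemma dot_congruence:
  fixes A L :: "real^'m^'m"
  shows "x \<bullet> ((transpose L ** A ** L) *v x) = (L *v x) \<bullet> (A *v (L *v x))"
  by (metis dot_lmul_matrix matrix_vector_mul_assoc transpose_matrix_vector inner_commute)

text \<open>The orthogonal family over all indices supplies the columns of \<open>L\<close>.\<close>

lemma simultaneous_diagonalization:
  fixes A B :: "real^'m^'m"
  assumes A: "sym_pos_def A" and B: "transpose B = B"
  obtains L :: "real^'m^'m" and l where "invertible L" "transpose L ** A ** L = mat 1" "transpose L ** B ** L = diag l"
proof -
  obtain v :: "'m \<Rightarrow> real^'m" where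
    vA: "\<And>i j. v i \<bullet> (A *v v j) = (if i = j then 1 else 0)" and
    vB: "\<And>i j. i \<noteq> j \<Longrightarrow> v i \<bullet> (B *v v j) = 0"
    using simultaneous_orthogonal_family[OF A B finite_class.finite_UNIV] by auto
  define L :: "real^'m^'m" where "L = (\<chi> i j. v j $ i)"
  have col: "column i L = v i" for i by (simp add: L_def column_def vec_eq_iff)
  have LA: "transpose L ** A ** L = mat 1"
    by (simp add: vec_eq_iff congruence_entry col vA mat_def)
  moreover have "transpose L ** B ** L = diag (\<lambda>i. v i \<bullet> (B *v v i))"
    by (auto simp: vec_eq_iff congruence_entry col vB diag_def)
  moreover have "invertible L"
    using LA invertible_left_inverse by blast
  ultimately show ?thesis using that by blast
qed

lemma det_congruence:
  fixes A L :: "real^'m^'m"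
  shows "det (transpose L ** A ** L) = (det L)\<^sup>2 * det A"
  by (simp add: det_mul power2_eq_square)

text \<open>A congruence to the identity gives \<open>(det L)^2 * det A = 1\<close>.\<close>

lemma sym_pos_def_det_pos: 
  fixes A :: "real^'m^'m" assumes "sym_pos_def A" shows "det A > 0"
proof -
  obtain L :: "real^'m^'m" and l :: "'m \<Rightarrow> real" where L: "transpose L ** A ** L = mat 1"
    using simultaneous_diagonalization[OF assms, of A] assms by (auto simp: sym_pos_def_def)
  then have "(det L)\<^sup>2 * det A = 1" by (metis det_I det_congruence)
  then show ?thesis by (metis zero_less_mult_pos zero_less_one zero_le_power2 mult_zero_left order_le_less)
qed

lemma diag_entry_pos: 
  fixes B L :: "real^'m^'m"
  assumes B: "sym_pos_def B" and L: "invertible L" "transpose L ** B ** L = diag l"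
  shows "l i > 0"
proof -
  have "l i = axis i 1 \<bullet> (diag l *v axis i 1)"
    by (simp add: diag_mult_vec inner_axis')
  also have "\<dots> = (L *v axis i 1) \<bullet> (B *v (L *v axis i 1))"
    unfolding L(2)[symmetric] by (rule dot_congruence)
  also have "\<dots> > 0"
  proof -
    have "L *v axis i 1 \<noteq> 0"
      using L(1) unfolding invertible_left_inverse matrix_left_invertible_ker
      by (auto simp: axis_eq_0_iff)
    then show ?thesis using B by (simp add: sym_pos_def_def)
  qed
  finally show ?thesis .
qed

lemma congruence_cancel:
  fixes A B L :: "real^'m^'m"
  assumes "invertible L" "transpose L ** A ** L = transpose L ** B ** L"
  shows "A = B"
proof -
  obtain M where M: "L ** M = mat 1" "M ** L = mat 1" using assms(1) by (auto simp: invertible_def)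
  have MT: "transpose M ** transpose L = mat 1" by (metis M(1) matrix_transpose_mul transpose_mat)
  have "A = (transpose M ** transpose L) ** A ** (L ** M)" by (simp add: M MT)
  also have "\<dots> = (transpose M ** transpose L) ** B ** (L ** M)"
    using arg_cong[OF assms(2), of "\<lambda>X. transpose M ** X ** M"] by (simp add: matrix_mul_assoc)
  finally show ?thesis by (simp add: M MT)
qed

text \<open>A congruence turns \<open>A\<close> into the identity and \<open>B\<close> into a
  diagonal matrix whose positive entries have product 1; what remains is AM-GM for each pair 1,
  \<open>l i\<close>. The strict case drives uniqueness of the minimal ellipsoid.\<close>

lemma det_midpoint:
  fixes A B :: "real^'m^'m"
  assumes A: "sym_pos_def A" and B: "sym_pos_def B" and eq: "det A = det B"
  shows "det A \<le> det ((1/2) *\<^sub>R (A + B))" "A \<noteq> B \<Longrightarrow> det A < det ((1/2) *\<^sub>R (A + B))"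
proof -
  obtain L :: "real^'m^'m" and l :: "'m \<Rightarrow> real" where L: "invertible L" "transpose L ** A ** L = mat 1" "transpose L ** B ** L = diag l"
    using simultaneous_diagonalization[OF A, of B] B by (auto simp: sym_pos_def_def)
  have dA: "(det L)\<^sup>2 * det A = 1" by (metis L(2) det_I det_congruence)
  have l: "l i > 0" for i using diag_entry_pos[OF B L(1,3)] .
  have prod1: "(\<Prod>i\<in>UNIV. l i) = 1"
    by (metis L(3) dA det_congruence det_diag eq)
  have sum: "transpose L ** ((1/2) *\<^sub>R (A + B)) ** L = diag (\<lambda>i. (1 + l i) / 2)"
  proof -
    have *: "transpose L ** ((1/2) *\<^sub>R (A + B)) ** L = (1/2) *\<^sub>R (transpose L ** A ** L + transpose L ** B ** L)"
      by (simp add: vec_eq_iff congruence_entry matrix_vector_mult_add_rdistrib inner_add_right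
          scaleR_matrix_vector_assoc[symmetric])
    show ?thesis unfolding * L by (simp add: vec_eq_iff diag_def mat_def)
  qed
  \<comment> \<open>Squared arithmetic mean of 1 and \<open>l i\<close> over their squared geometric
    mean. It equals 1 only at \<open>l i = 1\<close>, and the denominators cancel in the product
    because the \<open>l i\<close> multiply to 1.\<close>
  define f where "f i = (1 + l i)\<^sup>2 / (4 * l i)" for i
  have f1: "f i = 1 + (l i - 1)\<^sup>2 / (4 * l i)" for i
    using l[of i] by (simp add: f_def field_simps power2_eq_square)
  have f_ge: "1 \<le> f i" for i using l[of i] by (simp add: f1)
  have D: "((det L)\<^sup>2 * det ((1/2) *\<^sub>R (A + B)))\<^sup>2 = (\<Prod>i\<in>UNIV. f i)"
  proof -
    have "(\<Prod>i\<in>UNIV. (1 + l i) / 2)\<^sup>2 = (\<Prod>i\<in>UNIV. f i * l i)"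
      unfolding prod_power_distrib
      by (rule prod.cong) (use l in \<open>auto simp: f_def power2_eq_square field_simps less_imp_neq[symmetric]\<close>)
    then show ?thesis
      by (simp only: det_congruence[symmetric] sum det_diag prod.distrib prod1 mult_1_right)
  qed
  have pos: "(det L)\<^sup>2 * det ((1/2) *\<^sub>R (A + B)) > 0"
    unfolding det_congruence[symmetric] sum det_diag by (intro prod_pos) (use l in \<open>auto intro: add_pos_pos\<close>)
  have L2: "(det L)\<^sup>2 > 0" using dA by (metis mult_zero_left zero_less_power2 zero_neq_one zero_power2)
  have "1 \<le> (\<Prod>i\<in>UNIV. f i)" by (rule prod_ge_1) (rule f_ge)
  then have "1 \<le> (det L)\<^sup>2 * det ((1/2) *\<^sub>R (A + B))"
    unfolding D[symmetric] using pos by (smt (verit) power2_le_imp_le one_power2)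
  then show "det A \<le> det ((1/2) *\<^sub>R (A + B))" using dA L2 by (metis mult_le_cancel_left_pos)
  show "det A < det ((1/2) *\<^sub>R (A + B))" if "A \<noteq> B"
  proof -
    obtain k where k: "l k \<noteq> 1"
    proof (rule ccontr)
      assume "\<not> thesis"
      then have "l = (\<lambda>_. 1)" using that by blast
      then have "A = B" using congruence_cancel[OF L(1), of A B] L by (simp add: diag_1)
      then show False using \<open>A \<noteq> B\<close> by simp
    qed
    have "1 < f k" using k l[of k] by (simp add: f1)
    also have "f k * 1 \<le> f k * (\<Prod>i\<in>UNIV - {k}. f i)"
      by (intro mult_left_mono prod_ge_1 f_ge) (use f_ge[of k] in linarith)
    also have "\<dots> = (\<Prod>i\<in>UNIV. f i)" by (simp add: prod.remove[of UNIV k])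
    finally have "1 < (det L)\<^sup>2 * det ((1/2) *\<^sub>R (A + B))"
      unfolding D[symmetric] using pos by (smt (verit) power2_less_imp_less one_power2 mult.right_neutral power_mono)
    then show ?thesis using dA L2 by (metis mult_less_cancel_left_pos)
  qed
qed

text \<open>Diagonalizing against the identity makes \<open>L\<close> orthogonal and the
  \<open>l i\<close> the eigenvalues of \<open>Q\<close>. Their product is at least \<open>D\<close>
  and all of them are at most \<open>M\<close>, so none can be smaller than \<open>D\<close> over
  the product of \<open>n - 1\<close> factors \<open>M\<close>.\<close>

lemma quadratic_form_ge_of_det:
  fixes Q :: "real^'m^'m"
  assumes sym: "transpose Q = Q" and nn: "\<And>y. 0 \<le> y \<bullet> (Q *v y)"
    and le: "\<And>y. y \<bullet> (Q *v y) \<le> M * (y \<bullet> y)" and M: "M > 0" and D: "D \<le> det Q"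
  shows "D / M ^ (CARD('m) - 1) * (y \<bullet> y) \<le> y \<bullet> (Q *v y)"
proof -
  have I: "sym_pos_def (mat 1 :: real^'m^'m)" by (simp add: sym_pos_def_def transpose_mat)
  obtain L :: "real^'m^'m" and l :: "'m \<Rightarrow> real" where L: "invertible L" "transpose L ** L = mat 1" "transpose L ** Q ** L = diag l"
    using simultaneous_diagonalization[OF I sym] by auto
  have LL: "L ** transpose L = mat 1" using L(2) matrix_left_right_inverse by blast
  have dot: "(L *v x) \<bullet> (L *v x) = x \<bullet> x" for x
    using dot_congruence[of x L "mat 1"] L(2) by simp
  have form: "(L *v x) \<bullet> (Q *v (L *v x)) = (\<Sum>i\<in>UNIV. l i * (x $ i)\<^sup>2)" for x
    unfolding dot_congruence[symmetric] L(3) dot_diag ..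
  have li: "l i = (L *v axis i 1) \<bullet> (Q *v (L *v axis i 1))" for i
    unfolding dot_congruence[symmetric] L(3) by (simp add: diag_mult_vec inner_axis')
  have l0: "0 \<le> l i" for i unfolding li by (rule nn)
  have lM: "l i \<le> M" for i
    using le[of "L *v axis i 1"] unfolding li[symmetric] dot by (simp add: inner_axis')
  have "(det L)\<^sup>2 = 1" by (metis L(2) det_I det_mul det_transpose power2_eq_square)
  then have detQ: "det Q = (\<Prod>i\<in>UNIV. l i)" by (metis L(3) det_congruence det_diag mult_1)
  have lk: "D / M ^ (CARD('m) - 1) \<le> l k" for k
  proof -
    have "D \<le> l k * (\<Prod>i\<in>UNIV - {k}. l i)" using D unfolding detQ by (simp add: prod.remove[of UNIV k])
    also have "\<dots> \<le> l k * (\<Prod>i\<in>UNIV - {k}. M)"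
      by (intro mult_left_mono prod_mono) (use l0 lM in auto)
    finally show ?thesis using M by (simp add: field_simps)
  qed
  define x where "x = transpose L *v y"
  have y: "y = L *v x" by (metis LL matrix_vector_mul_assoc matrix_vector_mul_lid x_def)
  have "D / M ^ (CARD('m) - 1) * (x $ i \<bullet> x $ i) \<le> l i * (x $ i)\<^sup>2" for i
    using mult_right_mono[OF lk, of "(x $ i)\<^sup>2"] by (simp add: power2_eq_square)
  then show ?thesis
    unfolding y dot form unfolding inner_vec_def sum_distrib_left by (intro sum_mono)
qed

subsection \<open>Existence and uniqueness of the minimal ellipsoid\<close>

lemma continuous_on_matrix_vector_mult [continuous_intros]:
  fixes f :: "'a::topological_space \<Rightarrow> real^'n^'m"
  assumes "continuous_on S f" "continuous_on S g"
  shows "continuous_on S (\<lambda>x. f x *v g x)"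
  unfolding matrix_vector_mult_def by (intro continuous_intros continuous_on_vec_lambda assms)

lemma continuous_on_det [continuous_intros]:
  fixes f :: "'a::topological_space \<Rightarrow> real^'n^'n"
  assumes "continuous_on S f"
  shows "continuous_on S (\<lambda>x. det (f x))"
  unfolding det_def by (intro continuous_intros assms)

lemma det_scaleR: "det (k *\<^sub>R Q) = k ^ CARD('n) * det (Q :: real^'n^'n)"
proof -
  have "k *\<^sub>R Q = diag (\<lambda>_. k) ** Q"
    by (simp add: diag_def matrix_matrix_mult_def vec_eq_iff if_distrib if_distribR cong: if_cong)
  then show ?thesis by (simp add: det_mul det_diag)
qed

lemma dot_scaleR_matrix:
  fixes Q :: "real^'n^'m"
  shows "x \<bullet> ((k *\<^sub>R Q) *v y) = k * (x \<bullet> (Q *v y))"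
  by (simp add: scaleR_matrix_vector_assoc[symmetric])

lemma sym_pos_def_scaleR: "sym_pos_def Q \<Longrightarrow> k > 0 \<Longrightarrow> sym_pos_def (k *\<^sub>R Q)"
  by (simp add: sym_pos_def_def transpose_scalar dot_scaleR_matrix)

lemma dot_add_matrix: "x \<bullet> ((A + B) *v y) = x \<bullet> (A *v y) + x \<bullet> (B *v y)"
  by (simp add: matrix_vector_mult_add_rdistrib inner_add_right)

lemma transpose_add: "transpose (A + B) = transpose A + transpose B"
  by (simp add: transpose_def vec_eq_iff)

lemma sym_pos_def_add: "sym_pos_def A \<Longrightarrow> sym_pos_def B \<Longrightarrow> sym_pos_def (A + B)"
  by (simp add: sym_pos_def_def dot_add_matrix transpose_add add_pos_pos)

lemma ln_ellipsoid_vol: "det Q > 0 \<Longrightarrow> ln (ellipsoid_vol Q) = - ln (det Q) / 2"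
  by (simp add: ellipsoid_vol_def ln_powr)

lemma ellipsoid_vol_le_iff:
  assumes "det Q > 0" "det Q' > 0"
  shows "ellipsoid_vol Q \<le> ellipsoid_vol Q' \<longleftrightarrow> det Q' \<le> det Q"
proof -
  have "ellipsoid_vol Q > 0" "ellipsoid_vol Q' > 0" using assms by (auto simp: ellipsoid_vol_def)
  then have "ellipsoid_vol Q \<le> ellipsoid_vol Q' \<longleftrightarrow> ln (ellipsoid_vol Q) \<le> ln (ellipsoid_vol Q')" by simp
  also have "\<dots> \<longleftrightarrow> det Q' \<le> det Q" using assms by (simp add: ln_ellipsoid_vol)
  finally show ?thesis .
qed

lemma is_min_CE_iff_det:
  "is_min_CE K c Q \<longleftrightarrow> sym_pos_def Q \<and> K \<subseteq> ellipsoid c Q \<and>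
     (\<forall>c' Q'. sym_pos_def Q' \<and> K \<subseteq> ellipsoid c' Q' \<longrightarrow> det Q' \<le> det Q)"
  unfolding is_min_CE_def using ellipsoid_vol_le_iff sym_pos_def_det_pos by blast

text \<open>Averaging the two quadratic inequalities yields an ellipsoid with matrix the mean of
  \<open>Q1\<close> and \<open>Q2\<close>. Distinct matrices raise the determinant; distinct centers
  leave slack, which allows the matrix to be scaled up.\<close>

lemma is_min_CE_unique:
  fixes Q1 Q2 :: "real^'n^'n"
  assumes 1: "is_min_CE K c1 Q1" and 2: "is_min_CE K c2 Q2"
  shows "c1 = c2 \<and> Q1 = Q2"
proof -
  have s: "sym_pos_def Q1" "sym_pos_def Q2" and K: "K \<subseteq> ellipsoid c1 Q1" "K \<subseteq> ellipsoid c2 Q2"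
    and sym: "transpose Q1 = Q1" "transpose Q2 = Q2"
    using 1 2 by (auto simp: is_min_CE_def sym_pos_def_def)
  have opt: "\<And>c' Q'. sym_pos_def Q' \<Longrightarrow> K \<subseteq> ellipsoid c' Q' \<Longrightarrow> det Q' \<le> det Q1"
    using 1 by (auto simp: is_min_CE_iff_det)
  have deq: "det Q1 = det Q2" using 1 2 by (auto simp: is_min_CE_iff_det intro!: antisym)
  define Q where "Q = (1/2) *\<^sub>R (Q1 + Q2)"
  have Q: "sym_pos_def Q" unfolding Q_def by (intro sym_pos_def_scaleR sym_pos_def_add s) simp
  have "invertible Q" using sym_pos_def_det_pos[OF Q] by (simp add: invertible_det_nz)
  then obtain R where R: "Q ** R = mat 1" by (auto simp: invertible_def)
  \<comment> \<open>The minimizer of the averaged quadratic, chosen so that the linear terms about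
    \<open>c\<close> cancel.\<close>
  define c where "c = R *v ((1/2) *\<^sub>R (Q1 *v c1 + Q2 *v c2))"
  have Qc: "Q *v c = (1/2) *\<^sub>R (Q1 *v c1 + Q2 *v c2)"
    by (simp add: c_def matrix_vector_mul_assoc R)
  have bal: "Q1 *v (c1 - c) + Q2 *v (c2 - c) = 0"
  proof -
    have "Q1 *v c + Q2 *v c = 2 *\<^sub>R (Q *v c)"
      by (simp add: Q_def scaleR_matrix_vector_assoc[symmetric] matrix_vector_mult_add_rdistrib)
    then show ?thesis unfolding Qc by (simp add: matrix_vector_mult_diff_distrib algebra_simps)
  qed
  \<comment> \<open>The slack: on \<open>K\<close> the form of \<open>Q\<close> about
    \<open>c\<close> is at most \<open>1 - \<delta>\<close>, so scaling by
    \<open>1 + \<delta>\<close> is affordable because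
    \<open>(1 + \<delta>) * (1 - \<delta>) \<le> 1\<close>.\<close>
  define \<delta> where "\<delta> = ((c1 - c) \<bullet> (Q1 *v (c1 - c)) + (c2 - c) \<bullet> (Q2 *v (c2 - c))) / 2"
  have nn: "x \<bullet> (Q1 *v x) \<ge> 0" "x \<bullet> (Q2 *v x) \<ge> 0" for x
    using s by (cases "x = 0"; force simp: sym_pos_def_def less_imp_le)+
  have d0: "\<delta> \<ge> 0" using nn by (simp add: \<delta>_def)
  have sub: "K \<subseteq> ellipsoid c ((1 + \<delta>) *\<^sub>R Q)"
  proof
    fix y assume y: "y \<in> K"
    have shift: "(y - c) \<bullet> (A *v (y - c)) = (y - d) \<bullet> (A *v (y - d)) + 2 * ((y - c) \<bullet> (A *v (d - c)))
        - (d - c) \<bullet> (A *v (d - c))" if "transpose A = A" for d and A :: "real^'n^'n"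
      using quadratic_form_add[OF that, of "y - c" "-1" "d - c"] by simp
    have "(y - c) \<bullet> (Q *v (y - c)) = ((y - c) \<bullet> (Q1 *v (y - c)) + (y - c) \<bullet> (Q2 *v (y - c))) / 2"
      by (simp add: Q_def dot_scaleR_matrix dot_add_matrix)
    also have "\<dots> = ((y - c1) \<bullet> (Q1 *v (y - c1)) + (y - c2) \<bullet> (Q2 *v (y - c2))) / 2
        + (y - c) \<bullet> (Q1 *v (c1 - c) + Q2 *v (c2 - c)) - \<delta>"
      unfolding shift[OF sym(1), of c1] shift[OF sym(2), of c2]
      by (simp add: \<delta>_def inner_add_right field_simps)
    also have "\<dots> \<le> 1 - \<delta>"
      unfolding bal using K y by (force simp: ellipsoid_def)
    finally have "(y - c) \<bullet> (Q *v (y - c)) \<le> 1 - \<delta>" .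
    then have "(1 + \<delta>) * ((y - c) \<bullet> (Q *v (y - c))) \<le> (1 + \<delta>) * (1 - \<delta>)"
      using d0 by (intro mult_left_mono) auto
    also have "\<dots> \<le> 1" by (simp add: algebra_simps)
    finally show "y \<in> ellipsoid c ((1 + \<delta>) *\<^sub>R Q)"
      by (simp add: ellipsoid_def dot_scaleR_matrix)
  qed
  have "det ((1 + \<delta>) *\<^sub>R Q) \<le> det Q1"
    by (rule opt[OF sym_pos_def_scaleR[OF Q] sub]) (use d0 in simp)
  then have le: "(1 + \<delta>) ^ CARD('n) * det Q \<le> det Q1" by (simp add: det_scaleR)
  have Qpos: "det Q > 0" using sym_pos_def_det_pos[OF Q] .
  have "1 * det Q \<le> (1 + \<delta>) ^ CARD('n) * det Q"
    using d0 Qpos by (intro mult_right_mono) auto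
  then have "\<not> det Q1 < det Q" using le by simp
  then have Qeq: "Q1 = Q2" using det_midpoint(2)[OF s deq] unfolding Q_def by blast
  have "det Q1 \<le> det Q" using det_midpoint(1)[OF s deq] unfolding Q_def .
  then have "(1 + \<delta>) ^ CARD('n) * det Q \<le> 1 * det Q" using le by simp
  then have "(1 + \<delta>) ^ CARD('n) \<le> 1" using Qpos by (metis mult_le_cancel_right_pos)
  then have "\<delta> = 0" using d0 one_less_power[of "1 + \<delta>" "CARD('n)"] by fastforce
  then have "(c1 - c) \<bullet> (Q1 *v (c1 - c)) = 0" "(c2 - c) \<bullet> (Q2 *v (c2 - c)) = 0"
    using nn(1)[of "c1 - c"] nn(2)[of "c2 - c"] by (simp_all add: \<delta>_def add_nonneg_eq_0_iff)
  then have "c1 - c = 0 \<and> c2 - c = 0" using s unfolding sym_pos_def_def by (metis less_irrefl)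
  then show ?thesis using Qeq by simp
qed

text \<open>Adding the membership inequalities for \<open>u\<close> and \<open>- u\<close> cancels
  the cross terms.\<close>

lemma ellipsoid_symmetric_form_le:
  assumes sym: "transpose Q = Q" and "u \<in> ellipsoid c Q" "- u \<in> ellipsoid c Q"
  shows "u \<bullet> (Q *v u) + c \<bullet> (Q *v c) \<le> 1"
proof -
  have "(u - c) \<bullet> (Q *v (u - c)) \<le> 1" "(- u - c) \<bullet> (Q *v (- u - c)) \<le> 1"
    using assms(2,3) by (auto simp: ellipsoid_def)
  moreover have "Q *v (- u) = - (Q *v u)" by (metis linear_neg matrix_vector_mul_linear)
  ultimately show ?thesis
    using quadratic_form_add[OF sym, of u "-1" c] quadratic_form_add[OF sym, of "-u" "-1" c]
    by simp
qed

text \<open>The ball is symmetric, so the preceding bound at vectors of norm \<open>\<rho>\<close>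
  caps the eigenvalues by \<open>1 / \<rho>^2\<close>, and at 0 it bounds the center. The
  determinant then keeps every eigenvalue away from 0, the exponent counting the
  \<open>n - 1\<close> others. This serves both compactness in the existence proof and the constant
  \<open>\<sigma>\<close> of the theorem.\<close>

lemma ellipsoid_cball_bounds:
  fixes Q :: "real^'n^'n"
  assumes sym: "transpose Q = Q" and nn: "\<And>y. 0 \<le> y \<bullet> (Q *v y)"
    and sub: "cball 0 \<rho> \<subseteq> ellipsoid c Q" and \<rho>: "\<rho> > 0" and D: "D \<le> det Q"
  shows "y \<bullet> (Q *v y) \<le> 1 / \<rho>\<^sup>2 * (y \<bullet> y)" "c \<bullet> (Q *v c) \<le> 1"
    "D * \<rho> ^ (2 * (CARD('n) - 1)) * (y \<bullet> y) \<le> y \<bullet> (Q *v y)"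
proof -
  have b: "u \<bullet> (Q *v u) + c \<bullet> (Q *v c) \<le> 1" if "norm u \<le> \<rho>" for u
    by (rule ellipsoid_symmetric_form_le[OF sym]) (use that sub in auto)
  have le: "y \<bullet> (Q *v y) \<le> 1 / \<rho>\<^sup>2 * (y \<bullet> y)" for y
  proof (cases "y = 0")
    case False
    have "norm ((\<rho> / norm y) *\<^sub>R y) \<le> \<rho>" using \<rho> False by simp
    from b[OF this] have "(\<rho> / norm y)\<^sup>2 * (y \<bullet> (Q *v y)) \<le> 1"
      using nn[of c] by (simp add: matrix_vector_mult_scaleR power2_eq_square)
    then show ?thesis
      using False \<rho> by (simp add: field_simps power2_norm_eq_inner)
  qed simp
  then show "y \<bullet> (Q *v y) \<le> 1 / \<rho>\<^sup>2 * (y \<bullet> y)" .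
  show "c \<bullet> (Q *v c) \<le> 1" using b[of 0] \<rho> by simp
  have "D / (1 / \<rho>\<^sup>2) ^ (CARD('n) - 1) * (y \<bullet> y) \<le> y \<bullet> (Q *v y)"
    by (rule quadratic_form_ge_of_det[OF sym nn le _ D]) (use \<rho> in simp)
  then show "D * \<rho> ^ (2 * (CARD('n) - 1)) * (y \<bullet> y) \<le> y \<bullet> (Q *v y)"
    by (simp add: power_divide power_mult)
qed

text \<open>Nonnegativity at the sum and the difference of two basis vectors bounds twice the entry
  by two diagonal entries.\<close>

lemma psd_entry_bound:
  fixes Q :: "real^'n^'n"
  assumes sym: "transpose Q = Q" and nn: "\<And>y. 0 \<le> y \<bullet> (Q *v y)"
    and le: "\<And>y. y \<bullet> (Q *v y) \<le> M * (y \<bullet> y)"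
  shows "\<bar>Q $ i $ j\<bar> \<le> M"
proof -
  have e: "axis k 1 \<bullet> (Q *v axis l 1) = Q $ k $ l" for k l
    by (simp add: inner_axis' matrix_vector_mul_component inner_axis)
  have d: "Q $ k $ k \<le> M" for k using le[of "axis k 1"] unfolding e by (simp add: inner_axis_axis)
  show ?thesis
    using quadratic_form_add[OF sym, of "axis i 1" 1 "axis j 1"] quadratic_form_add[OF sym, of "axis i 1" "-1" "axis j 1"]
      nn[of "axis i 1 + 1 *\<^sub>R axis j 1"] nn[of "axis i 1 + (-1) *\<^sub>R axis j 1"] d[of i] d[of j]
    unfolding e by (simp add: abs_le_iff)
qed

lemma norm_matrix_le:
  fixes Q :: "real^'n^'m"
  assumes "\<And>i j. \<bar>Q $ i $ j\<bar> \<le> M"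
  shows "norm Q \<le> real CARD('m) * (real CARD('n) * M)"
proof -
  have "norm Q \<le> (\<Sum>i\<in>UNIV. norm (Q $ i))" unfolding norm_vec_def by (rule L2_set_le_sum) simp
  also have "\<dots> \<le> (\<Sum>i\<in>UNIV. \<Sum>j\<in>UNIV. \<bar>Q $ i $ j\<bar>)" by (intro sum_mono norm_le_l1_cart)
  also have "\<dots> \<le> (\<Sum>i\<in>(UNIV::'m set). \<Sum>j\<in>(UNIV::'n set). M)" by (intro sum_mono assms)
  finally show ?thesis by simp
qed

text \<open>The determinant attains its maximum on a compact set of feasible pairs; pairs outside it
  have smaller determinant.\<close>

lemma is_min_CE_exists:
  fixes K :: "(real^'n) set"
  assumes "bounded K" and \<rho>: "\<rho> > 0" and K: "cball 0 \<rho> \<subseteq> K"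
  shows "\<exists>c Q. is_min_CE K c Q"
proof -
  obtain R where R: "R > 0" "\<And>x. x \<in> K \<Longrightarrow> norm x \<le> R"
    using \<open>bounded K\<close> by (meson bounded_pos)
  \<comment> \<open>The determinant belonging to the ball of radius \<open>R\<close> about 0, a
    feasible ellipsoid.\<close>
  define D :: real where "D = (1 / R\<^sup>2) ^ CARD('n)"
  have D: "D > 0" using R by (simp add: D_def)
  \<comment> \<open>Semidefiniteness keeps \<open>F\<close> closed; the lower bound \<open>D\<close>
    on the determinant restores definiteness and bounds the centers.\<close>
  define F :: "((real^'n) \<times> (real^'n^'n)) set" where
    "F = {p. transpose (snd p) = snd p} \<inter> (\<Inter>y. {p. 0 \<le> y \<bullet> (snd p *v y)}) \<inter>
      (\<Inter>k\<in>K. {p. (k - fst p) \<bullet> (snd p *v (k - fst p)) \<le> 1}) \<inter> {p. D \<le> det (snd p)}"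
  have F_iff: "(c, Q) \<in> F \<longleftrightarrow> transpose Q = Q \<and> (\<forall>y. 0 \<le> y \<bullet> (Q *v y)) \<and> K \<subseteq> ellipsoid c Q \<and> D \<le> det Q" for c Q
    by (auto simp: F_def ellipsoid_def)
  have "closed F" unfolding F_def transpose_def
    by (intro closed_Int closed_INT ballI closed_Collect_eq closed_Collect_le continuous_intros continuous_on_vec_lambda)
  moreover have "bounded F"
  proof -
    define N where "N = real CARD('n) * (real CARD('n) * (1 / \<rho>\<^sup>2))"
    define s where "s = D * \<rho> ^ (2 * (CARD('n) - 1))"
    have s: "s > 0" using D \<rho> by (simp add: s_def)
    have "F \<subseteq> cball 0 (sqrt (1 / s)) \<times> cball 0 N"
    proof clarify
      fix c Q assume "(c, Q) \<in> F"
      then have *: "transpose Q = Q" "\<And>y. 0 \<le> y \<bullet> (Q *v y)" "cball 0 \<rho> \<subseteq> ellipsoid c Q" "D \<le> det Q"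
        using K unfolding F_iff by auto
      note b = ellipsoid_cball_bounds[OF *(1-3) \<rho> *(4)]
      have "s * (c \<bullet> c) \<le> 1" using b(2) b(3)[of c] unfolding s_def by linarith
      then have "(norm c)\<^sup>2 \<le> 1 / s" using s by (simp add: power2_norm_eq_inner field_simps)
      then have "norm c \<le> sqrt (1 / s)" by (rule real_le_rsqrt)
      moreover have "norm Q \<le> N" unfolding N_def
        by (intro norm_matrix_le psd_entry_bound[OF *(1,2) b(1)])
      ultimately show "c \<in> cball 0 (sqrt (1 / s)) \<and> Q \<in> cball 0 N" by simp
    qed
    then show ?thesis by (rule bounded_subset[OF bounded_Times[OF bounded_cball bounded_cball]])
  qed
  ultimately have comp: "compact F" by (simp add: compact_eq_bounded_closed)
  have "(0, (1 / R\<^sup>2) *\<^sub>R mat 1) \<in> F"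
    unfolding F_iff
  proof (intro conjI allI subsetI)
    fix x assume "x \<in> K"
    then have "(norm x)\<^sup>2 \<le> R\<^sup>2" using R by (intro power_mono) auto
    then show "x \<in> ellipsoid 0 ((1 / R\<^sup>2) *\<^sub>R mat 1)"
      using R by (simp add: ellipsoid_def dot_scaleR_matrix power2_norm_eq_inner)
  qed (auto simp: transpose_scalar dot_scaleR_matrix det_scaleR D_def)
  then have ne: "F \<noteq> {}" by blast
  have "continuous_on F (\<lambda>p. det (snd p))" by (intro continuous_intros)
  from continuous_attains_sup[OF comp ne this] obtain p where p: "p \<in> F" "\<forall>q\<in>F. det (snd q) \<le> det (snd p)" by blast
  obtain c Q where cQ: "p = (c, Q)" by (cases p)
  have f: "transpose Q = Q" "\<And>y. 0 \<le> y \<bullet> (Q *v y)" "K \<subseteq> ellipsoid c Q" "D \<le> det Q"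
    using p(1) unfolding cQ F_iff by auto
  have "is_min_CE K c Q" unfolding is_min_CE_iff_det
  proof (intro conjI allI impI f)
    have "D * \<rho> ^ (2 * (CARD('n) - 1)) * (y \<bullet> y) \<le> y \<bullet> (Q *v y)" for y
      by (rule ellipsoid_cball_bounds(3)[OF f(1,2) _ \<rho> f(4)]) (use f(3) K in auto)
    moreover have "D * \<rho> ^ (2 * (CARD('n) - 1)) * (y \<bullet> y) > 0" if "y \<noteq> 0" for y :: "real^'n"
      using that D \<rho> by simp
    ultimately show "sym_pos_def Q" using f(1) unfolding sym_pos_def_def by (metis order_less_le_trans)
  next
    fix c' Q' assume *: "sym_pos_def Q' \<and> K \<subseteq> ellipsoid c' Q'"
    show "det Q' \<le> det Q"
    proof (cases "D \<le> det Q'")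
      case True
      have "0 \<le> y \<bullet> (Q' *v y)" for y using * by (cases "y = 0") (auto simp: sym_pos_def_def less_imp_le)
      then have "(c', Q') \<in> F" using * True unfolding F_iff by (auto simp: sym_pos_def_def)
      then show ?thesis using p(2) unfolding cQ by force
    next
      case False
      then show ?thesis using f(4) by simp
    qed
  qed
  then show ?thesis by blast
qed

lemma is_min_CE_min_CE:
  assumes "bounded K" "\<rho> > 0" "cball 0 \<rho> \<subseteq> K"
  shows "is_min_CE K (fst (min_CE K)) (snd (min_CE K))"
proof -
  obtain c Q where cQ: "is_min_CE K c Q" using is_min_CE_exists[OF assms] by blast
  have "min_CE K = (c, Q)" unfolding min_CE_def
    by (rule the_equality) (auto dest: is_min_CE_unique[OF _ cQ] simp: cQ)
  then show ?thesis using cQ by simp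
qed

subsection \<open>Homogenization and first-order optimality\<close>

text \<open>The index \<open>None\<close> is the homogenizing coordinate. Border row and column are
  separate so that shears are covered as well as symmetric forms.\<close>

definition block :: "real \<Rightarrow> real^'n \<Rightarrow> real^'n \<Rightarrow> real^'n^'n \<Rightarrow> real^('n option)^('n option)" where
  "block \<alpha> r b M = (\<chi> i j. case i of None \<Rightarrow> (case j of None \<Rightarrow> \<alpha> | Some j \<Rightarrow> r $ j)
     | Some i \<Rightarrow> (case j of None \<Rightarrow> b $ i | Some j \<Rightarrow> M $ i $ j))"

definition lvec :: "real \<Rightarrow> real^'n \<Rightarrow> real^('n option)" where
  "lvec s y = (\<chi> i. case i of None \<Rightarrow> s | Some i \<Rightarrow> y $ i)"

lemma block_nth [simp]:
  "block \<alpha> r b M $ None $ None = \<alpha>" "block \<alpha> r b M $ None $ Some j = r $ j"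
  "block \<alpha> r b M $ Some i $ None = b $ i" "block \<alpha> r b M $ Some i $ Some j = M $ i $ j"
  by (auto simp: block_def)

lemma lvec_nth [simp]: "lvec s y $ None = s" "lvec s y $ Some i = y $ i"
  by (auto simp: lvec_def)

lemma sum_UNIV_option: "(\<Sum>i\<in>UNIV. f i) = f None + (\<Sum>i\<in>UNIV. f (Some i))"
  for f :: "'n::finite option \<Rightarrow> 'b::comm_monoid_add"
  by (simp add: UNIV_option_conv sum.reindex)

lemma prod_UNIV_option: "(\<Prod>i\<in>UNIV. f i) = f None * (\<Prod>i\<in>UNIV. f (Some i))"
  for f :: "'n::finite option \<Rightarrow> 'b::comm_monoid_mult"
  by (simp add: UNIV_option_conv prod.reindex)

lemma forall_option: "(\<forall>i. P i) \<longleftrightarrow> P None \<and> (\<forall>i. P (Some i))"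
  by (metis option.exhaust)

lemma block_mult_lvec: "block \<alpha> r b M *v lvec s y = lvec (\<alpha> * s + r \<bullet> y) (s *\<^sub>R b + M *v y)"
  by (simp add: vec_eq_iff forall_option matrix_vector_mult_def sum_UNIV_option inner_vec_def)

lemma lvec_dot: "lvec s y \<bullet> lvec s' y' = s * s' + y \<bullet> y'"
  by (simp add: inner_vec_def sum_UNIV_option)

lemma lvec_cases: obtains s y where "x = lvec s y"
  by (rule that[of "x $ None" "\<chi> i. x $ Some i"]) (simp add: vec_eq_iff forall_option)

lemma lvec_eq_0_iff: "lvec s y = 0 \<longleftrightarrow> s = 0 \<and> y = 0"
  by (auto simp: vec_eq_iff forall_option)

lemma transpose_block: "transpose (block \<alpha> r b M) = block \<alpha> b r (transpose M)"
  by (simp add: vec_eq_iff forall_option transpose_def)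

lemma block_cases: obtains \<alpha> r b M where "G = block \<alpha> r b M"
  by (rule that[of "G $ None $ None" "\<chi> j. G $ None $ Some j" "\<chi> i. G $ Some i $ None" "\<chi> i j. G $ Some i $ Some j"])
    (simp add: vec_eq_iff forall_option)

lemma block_eq_iff: "block \<alpha> r b M = block \<alpha>' r' b' M' \<longleftrightarrow> \<alpha> = \<alpha>' \<and> r = r' \<and> b = b' \<and> M = M'"
  by (auto simp: vec_eq_iff forall_option)

lemma block_dot: "lvec s y \<bullet> (block \<alpha> b b M *v lvec s y) = \<alpha> * s\<^sup>2 + 2 * s * (b \<bullet> y) + y \<bullet> (M *v y)"
  by (simp add: block_mult_lvec lvec_dot inner_add_right inner_commute algebra_simps power2_eq_square)

text \<open>In the Leibniz sum a permutation moving \<open>None\<close> picks up an entry of the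
  zero column; the others are the permutations of the \<open>Some\<close> indices, with the same
  sign.\<close>

lemma det_block_upper:
  fixes M :: "real^'n^'n"
  shows "det (block \<alpha> r 0 M) = \<alpha> * det M"
proof -
  let ?A = "block \<alpha> r 0 M"
  let ?f = "\<lambda>p. of_int (sign p) * (\<Prod>i\<in>UNIV. ?A $ i $ p i)"
  let ?R = "range (Some :: 'n \<Rightarrow> 'n option)"
  have bij: "bij_betw Some (UNIV :: 'n set) ?R" by (simp add: bij_betw_def)
  have "det ?A = (\<Sum>p | p permutes UNIV. ?f p)" by (simp add: det_def)
  also have "\<dots> = (\<Sum>p | p permutes ?R. ?f p)"
  proof (rule sum.mono_neutral_right)
    show "finite {p. p permutes (UNIV :: 'n option set)}" by (simp add: finite_permutations)
    show "{p. p permutes ?R} \<subseteq> {p. p permutes UNIV}" by (auto intro: permutes_subset[OF _ subset_UNIV])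
    show "\<forall>p\<in>{p. p permutes UNIV} - {p. p permutes ?R}. ?f p = 0"
    proof
      fix p assume p: "p \<in> {p. p permutes UNIV} - {p. p permutes ?R}"
      have "p None \<noteq> None"
      proof
        assume "p None = None"
        have "p permutes ?R"
        proof (rule permutes_superset)
          show "p permutes UNIV" using p by simp
          show "p x = x" if "x \<in> UNIV - ?R" for x
            using \<open>p None = None\<close> that by (cases x) auto
        qed
        then show False using p by simp
      qed
      moreover obtain i where i: "p i = None" using p permutes_surj[of p UNIV] by (metis DiffD1 mem_Collect_eq surjD)
      ultimately obtain k where "i = Some k" by (cases i) auto
      then have "?A $ i $ p i = 0" using i by simp
      then have "(\<Prod>i\<in>UNIV. ?A $ i $ p i) = 0" by (intro prod_zero bexI[of _ i]) auto
      then show "?f p = 0" by simp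
    qed
  qed
  also have "\<dots> = (\<Sum>q | q permutes UNIV. ?f (map_permutation UNIV Some q))"
  proof -
    have "map_permutation UNIV Some q = (\<lambda>x. if x \<in> ?R then Some (q (inv_into UNIV Some x)) else x)" for q :: "'n \<Rightarrow> 'n"
      by (auto simp: map_permutation_def restrict_id_def fun_eq_iff)
    then show ?thesis
      using sum.reindex_bij_betw[OF bij_betw_permutations[OF bij], of ?f] by simp
  qed
  also have "\<dots> = (\<Sum>q | q permutes UNIV. \<alpha> * (of_int (sign q) * (\<Prod>i\<in>UNIV. M $ i $ q i)))"
  proof (rule sum.cong)
    fix q assume q: "q \<in> {q. q permutes (UNIV :: 'n set)}"
    have "map_permutation UNIV Some q None = None" "map_permutation UNIV Some q (Some i) = Some (q i)" for i
      by (auto simp: map_permutation_def restrict_id_def)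
    then show "?f (map_permutation UNIV Some q) = \<alpha> * (of_int (sign q) * (\<Prod>i\<in>UNIV. M $ i $ q i))"
      using q by (simp add: prod_UNIV_option sign_map_permutation)
  qed simp
  finally show ?thesis by (simp add: det_def sum_distrib_left)
qed

text \<open>Block elimination: the matrix is an upper block factor with the Schur complement in its
  corner times a lower one with corner 1. The vector \<open>z\<close> stands for
  \<open>M^-1 b\<close>.\<close>

lemma det_block_schur:
  fixes M :: "real^'n^'n"
  assumes sym: "transpose M = M" and z: "M *v z = b"
  shows "det (block \<alpha> b b M) = (\<alpha> - b \<bullet> z) * det M"
proof -
  have "block \<alpha> b b M = block (\<alpha> - b \<bullet> z) z 0 (mat 1) ** block 1 0 b M"
  proof -
    have "(\<Sum>k\<in>UNIV. z $ k * M $ k $ j) = b $ j" for j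
    proof -
      have "(transpose M *v z) $ j = b $ j" unfolding sym z ..
      then show ?thesis by (simp add: matrix_vector_mult_def transpose_def mult.commute)
    qed
    then show ?thesis
      by (simp add: vec_eq_iff forall_option matrix_matrix_mult_def sum_UNIV_option mat_def
          inner_vec_def mult.commute if_distrib if_distribR cong: if_cong)
  qed
  moreover have "det (block 1 0 b M) = det M"
    using det_block_upper[of 1 b M] det_transpose[of "block 1 b 0 M"] by (simp add: transpose_block sym)
  ultimately show ?thesis by (simp add: det_mul det_block_upper)
qed

text \<open>The homogenization \<open>s\<^sup>2 + n (y - s c)\<^sup>T Q (y - s c)\<close> of an ellipsoid: on the lifted points
  \<open>(1, y)\<close> the ellipsoid is the sublevel set of level \<open>n + 1\<close>.\<close>

definition lift :: "real^'n \<Rightarrow> real^'n^'n \<Rightarrow> real^('n option)^('n option)" where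
  "lift c Q = block (1 + real CARD('n) * (c \<bullet> (Q *v c))) (- (real CARD('n) *\<^sub>R (Q *v c)))
      (- (real CARD('n) *\<^sub>R (Q *v c))) (real CARD('n) *\<^sub>R Q)"

lemma lift_dot:
  fixes Q :: "real^'n^'n"
  assumes "transpose Q = Q"
  shows "lvec s y \<bullet> (lift c Q *v lvec s y) = s\<^sup>2 + real CARD('n) * ((y - s *\<^sub>R c) \<bullet> (Q *v (y - s *\<^sub>R c)))"
  using quadratic_form_add[OF assms, of y "- s" c] symmetric_dot[OF assms, of y c]
  by (simp add: lift_def block_dot dot_scaleR_matrix inner_commute[of _ y] algebra_simps power2_eq_square)

text \<open>With \<open>z = - c\<close> the Schur complement of the corner is 1.\<close>

lemma det_lift:
  fixes Q :: "real^'n^'n"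
  assumes "transpose Q = Q"
  shows "det (lift c Q) = real CARD('n) ^ CARD('n) * det Q"
proof -
  have neg: "Q *v (- c) = - (Q *v c)" by (metis linear_neg matrix_vector_mul_linear)
  have "det (lift c Q) = (1 + real CARD('n) * (c \<bullet> (Q *v c)) - (- (real CARD('n) *\<^sub>R (Q *v c))) \<bullet> (- c)) * det (real CARD('n) *\<^sub>R Q)"
    unfolding lift_def by (rule det_block_schur) (auto simp: assms transpose_scalar scaleR_matrix_vector_assoc[symmetric] neg)
  then show ?thesis by (simp add: det_scaleR inner_commute)
qed

lemma sym_pos_def_lift:
  fixes Q :: "real^'n^'n"
  assumes "sym_pos_def Q" shows "sym_pos_def (lift c Q)"
  unfolding sym_pos_def_def
proof (intro conjI allI impI)
  have sym: "transpose Q = Q" and pos: "\<And>y. y \<noteq> 0 \<Longrightarrow> y \<bullet> (Q *v y) > 0" using assms by (auto simp: sym_pos_def_def)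
  show "transpose (lift c Q) = lift c Q" by (simp add: lift_def transpose_block transpose_scalar sym)
  fix x :: "real^('n option)" assume "x \<noteq> 0"
  obtain s y where x: "x = lvec s y" by (rule lvec_cases)
  have nn: "0 \<le> (y - s *\<^sub>R c) \<bullet> (Q *v (y - s *\<^sub>R c))"
    using pos[of "y - s *\<^sub>R c"] by (cases "y - s *\<^sub>R c = 0") auto
  show "x \<bullet> (lift c Q *v x) > 0"
  proof (cases "s = 0")
    case True
    then have "y \<noteq> 0" using \<open>x \<noteq> 0\<close> x by (simp add: lvec_eq_0_iff)
    then show ?thesis unfolding x lift_dot[OF sym] using True pos by simp
  next
    case False
    then show ?thesis unfolding x lift_dot[OF sym] using nn by (intro add_pos_nonneg) auto
  qed
qed

text \<open>AM-GM for \<open>\<gamma>\<close> and \<open>n\<close> copies of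
  \<open>\<delta> / n\<close>, obtained from \<open>ln x \<le> x - 1\<close>.\<close>

lemma mult_power_le_of_sum_eq:
  fixes \<gamma> \<delta> :: real
  assumes "\<gamma> > 0" "\<delta> > 0" "n > 0" "\<gamma> + \<delta> = real n + 1"
  shows "\<gamma> * \<delta> ^ n \<le> real n ^ n"
proof -
  have "ln (\<gamma> * (\<delta> / n) ^ n) = ln \<gamma> + n * ln (\<delta> / n)"
    using assms by (simp add: ln_mult ln_realpow)
  also have "\<dots> \<le> (\<gamma> - 1) + n * (\<delta> / n - 1)"
    using assms by (intro add_mono mult_left_mono ln_le_minus_one) auto
  also have "\<dots> = 0" using assms by (simp add: right_diff_distrib)
  finally have "\<gamma> * (\<delta> / n) ^ n \<le> 1" using assms by (subst (asm) ln_le_zero_iff) auto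
  then show ?thesis using assms by (simp add: power_divide field_simps)
qed

text \<open>Completing the square splits the level \<open>n + 1\<close> into the Schur complement
  \<open>\<gamma>\<close> and a remainder \<open>\<delta>\<close>. The points then lie in an
  ellipsoid with matrix \<open>M / \<delta>\<close>, so minimality bounds \<open>det M\<close>;
  AM-GM bounds the factor \<open>\<gamma> * \<delta> ^ n\<close>.\<close>

lemma lift_optimal:
  fixes Q :: "real^'n^'n" and p :: "'i \<Rightarrow> real^'n"
  assumes min: "is_min_CE K c Q"
    and gen: "\<And>c' Q'. sym_pos_def Q' \<Longrightarrow> (\<forall>i\<in>I. p i \<in> ellipsoid c' Q') \<Longrightarrow> K \<subseteq> ellipsoid c' Q'"
    and G: "sym_pos_def G" and le: "\<And>i. i \<in> I \<Longrightarrow> lvec 1 (p i) \<bullet> (G *v lvec 1 (p i)) \<le> real CARD('n) + 1"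
  shows "det G \<le> det (lift c Q)"
proof -
  let ?n = "CARD('n)"
  have n: "?n > 0" by simp
  have opt: "det Q' \<le> det Q" if "sym_pos_def Q'" "\<forall>i\<in>I. p i \<in> ellipsoid c' Q'" for c' Q'
    using min gen[OF that] that(1) by (auto simp: is_min_CE_iff_det)
  have Q: "sym_pos_def Q" using min by (simp add: is_min_CE_def)
  obtain \<alpha> r b M where G_block: "G = block \<alpha> r b M" by (rule block_cases)
  have Gsym: "transpose G = G" using G by (simp add: sym_pos_def_def)
  then have "r = b" and Msym: "transpose M = M"
    unfolding G_block transpose_block block_eq_iff by blast+
  then have Gb: "G = block \<alpha> b b M" using G_block by simp
  have Gpos: "x \<bullet> (G *v x) > 0" if "x \<noteq> 0" for x using G that by (simp add: sym_pos_def_def)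
  have M: "sym_pos_def M" unfolding sym_pos_def_def
  proof (intro conjI Msym allI impI)
    fix y :: "real^'n" assume "y \<noteq> 0"
    then show "0 < y \<bullet> (M *v y)" using Gpos[of "lvec 0 y"] by (simp add: lvec_eq_0_iff Gb block_dot)
  qed
  have dM: "det M > 0" by (rule sym_pos_def_det_pos[OF M])
  then obtain R where R: "M ** R = mat 1" by (metis invertible_def invertible_det_nz less_irrefl)
  define z where "z = R *v b"
  have z: "M *v z = b" by (simp add: z_def matrix_vector_mul_assoc R)
  define \<gamma> where "\<gamma> = \<alpha> - b \<bullet> z"
  define \<delta> where "\<delta> = real ?n + 1 - \<gamma>"
  have detG: "det G = \<gamma> * det M" unfolding Gb \<gamma>_def by (rule det_block_schur[OF Msym z])
  then have \<gamma>: "\<gamma> > 0" using sym_pos_def_det_pos[OF G] dM by (simp add: zero_less_mult_iff)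
  have pM: "(p i - (- z)) \<bullet> (M *v (p i - (- z))) \<le> \<delta>" if "i \<in> I" for i
  proof -
    have "(p i + 1 *\<^sub>R z) \<bullet> (M *v (p i + 1 *\<^sub>R z)) = \<alpha> + 2 * (b \<bullet> p i) + p i \<bullet> (M *v p i) - \<gamma>"
      unfolding quadratic_form_add[OF Msym] z \<gamma>_def by (simp add: inner_commute)
    also have "\<dots> \<le> \<delta>" using le[OF that] by (simp add: Gb block_dot \<delta>_def)
    finally show ?thesis by simp
  qed
  \<comment> \<open>Stated for every admissible \<open>k\<close>, because positivity of
    \<open>\<delta>\<close> is itself derived from it.\<close>
  have scaled: "k ^ ?n * det M \<le> det Q" if "k > 0" "k * \<delta> \<le> 1" for k
  proof -
    have "det (k *\<^sub>R M) \<le> det Q"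
    proof (rule opt[OF sym_pos_def_scaleR[OF M \<open>k > 0\<close>]], intro ballI)
      fix i assume "i \<in> I"
      have "k * ((p i - (- z)) \<bullet> (M *v (p i - (- z)))) \<le> k * \<delta>"
        using pM[OF \<open>i \<in> I\<close>] that by (intro mult_left_mono) auto
      from order_trans[OF this that(2)] show "p i \<in> ellipsoid (- z) (k *\<^sub>R M)"
        by (simp add: ellipsoid_def dot_scaleR_matrix)
    qed
    then show ?thesis by (simp add: det_scaleR)
  qed
  have \<delta>: "\<delta> > 0"
  proof (rule ccontr)
    assume neg: "\<not> \<delta> > 0"
    \<comment> \<open>For nonpositive \<open>\<delta>\<close> every positive scaling is admissible;
      this one makes \<open>k * det M\<close> exceed \<open>det Q\<close>, and
      \<open>k \<ge> 1\<close> gives \<open>k \<le> k ^ n\<close>.\<close>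
    define k where "k = 1 + det Q / det M"
    have dQ: "det Q > 0" by (rule sym_pos_def_det_pos[OF Q])
    have k: "k \<ge> 1" using dQ dM by (simp add: k_def)
    have "k * \<delta> \<le> 0" using neg k by (simp add: mult_le_0_iff)
    then have "k ^ ?n * det M \<le> det Q" using k by (intro scaled) auto
    moreover have "k * det M \<le> k ^ ?n * det M" using k dM self_le_power[OF k n] by simp
    moreover have "k * det M = det M + det Q" using dM by (simp add: k_def field_simps)
    ultimately show False using dM by simp
  qed
  have "(1 / \<delta>) ^ ?n * det M \<le> det Q" by (rule scaled) (use \<delta> in auto)
  then have "det M \<le> \<delta> ^ ?n * det Q" using \<delta> by (simp add: power_divide field_simps)
  then have "det G \<le> \<gamma> * (\<delta> ^ ?n * det Q)" unfolding detG using \<gamma> by simp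
  also have "\<dots> = (\<gamma> * \<delta> ^ ?n) * det Q" by simp
  also have "\<dots> \<le> real ?n ^ ?n * det Q"
    using \<gamma> \<delta> sym_pos_def_det_pos[OF Q] by (intro mult_right_mono mult_power_le_of_sum_eq) (auto simp: \<delta>_def)
  also have "\<dots> = det (lift c Q)" using Q by (simp add: det_lift sym_pos_def_def)
  finally show ?thesis .
qed

section \<open>First-order optimality of the lift\<close>

lemma sym_pos_def_of_congruence_diag:
  fixes A L :: "real^'m^'m"
  assumes "transpose A = A" "invertible L" "transpose L ** A ** L = diag l" "\<And>i. l i > 0"
  shows "sym_pos_def A"
  unfolding sym_pos_def_def
proof (intro conjI allI impI assms(1))
  fix y :: "real^'m" assume y: "y \<noteq> 0"
  obtain M where M: "L ** M = mat 1" using assms(2) by (auto simp: invertible_def)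
  define x where "x = M *v y"
  have yx: "y = L *v x" by (simp add: x_def matrix_vector_mul_assoc M)
  have "x \<noteq> 0" using y yx by auto
  then obtain k where k: "x $ k \<noteq> 0" by (auto simp: vec_eq_iff)
  have "y \<bullet> (A *v y) = (\<Sum>i\<in>UNIV. l i * (x $ i)\<^sup>2)"
    unfolding yx dot_congruence[symmetric] assms(3) dot_diag ..
  also have "\<dots> > 0"
  proof (rule sum_pos2[of _ k])
    show "0 \<le> l i * (x $ i)\<^sup>2" for i using assms(4)[of i] by simp
  qed (use k assms(4) in auto)
  finally show "0 < y \<bullet> (A *v y)" .
qed

text \<open>The \<open>x j\<close> are the eigenvalues of \<open>\<Delta>\<close> relative to the
  optimal form. If their sum were positive, a small step along \<open>\<Delta>\<close> would stay
  feasible and increase the determinant, against \<open>lift_optimal\<close>.\<close>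

lemma lift_first_order:
  fixes Q :: "real^'n^'n" and p :: "'i \<Rightarrow> real^'n" and L :: "real^('n option)^('n option)"
  assumes min: "is_min_CE K c Q" and I: "finite I" and pK: "\<And>i. i \<in> I \<Longrightarrow> p i \<in> K"
    and gen: "\<And>c' Q'. sym_pos_def Q' \<Longrightarrow> (\<forall>i\<in>I. p i \<in> ellipsoid c' Q') \<Longrightarrow> K \<subseteq> ellipsoid c' Q'"
    and sym: "transpose \<Delta> = \<Delta>"
    and contact: "\<And>i. i \<in> I \<Longrightarrow> lvec 1 (p i) \<bullet> (lift c Q *v lvec 1 (p i)) = real CARD('n) + 1
        \<Longrightarrow> lvec 1 (p i) \<bullet> (\<Delta> *v lvec 1 (p i)) \<le> 0"
    and L: "invertible L" "transpose L ** lift c Q ** L = mat 1" "transpose L ** \<Delta> ** L = diag x"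
  shows "(\<Sum>j\<in>UNIV. x j) \<le> 0"
proof (rule ccontr)
  assume neg: "\<not> (\<Sum>j\<in>UNIV. x j) \<le> 0"
  let ?H = "lift c Q"
  let ?P = "\<lambda>i. lvec 1 (p i)"
  have Q: "sym_pos_def Q" and Qsym: "transpose Q = Q" and KE: "K \<subseteq> ellipsoid c Q"
    using min by (auto simp: is_min_CE_def sym_pos_def_def)
  have Hsym: "transpose ?H = ?H" using sym_pos_def_lift[OF Q] by (simp add: sym_pos_def_def)
  have ev1: "eventually (\<lambda>t. \<forall>j. 1 + t * x j > 0) (at_right 0)"
  proof (intro eventually_all_finite allI)
    fix j
    have "((\<lambda>t. 1 + t * x j) \<longlongrightarrow> 1 + 0 * x j) (at_right 0)" by (intro tendsto_intros)
    then show "eventually (\<lambda>t. 1 + t * x j > 0) (at_right 0)" by (rule order_tendstoD) simp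
  qed
  \<comment> \<open>Inactive constraints survive by continuity; at contact points the value does not
    rise.\<close>
  have ev2: "eventually (\<lambda>t. \<forall>i\<in>I. ?P i \<bullet> (?H *v ?P i) + t * (?P i \<bullet> (\<Delta> *v ?P i)) \<le> real CARD('n) + 1) (at_right 0)"
  proof (intro eventually_ball_finite I ballI)
    fix i assume i: "i \<in> I"
    have le: "?P i \<bullet> (?H *v ?P i) \<le> real CARD('n) + 1"
      using KE pK[OF i] by (auto simp: lift_dot[OF Qsym] ellipsoid_def)
    show "eventually (\<lambda>t. ?P i \<bullet> (?H *v ?P i) + t * (?P i \<bullet> (\<Delta> *v ?P i)) \<le> real CARD('n) + 1) (at_right 0)"
    proof (cases "?P i \<bullet> (?H *v ?P i) = real CARD('n) + 1")
      case True
      show ?thesis using eventually_at_right_less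
        by eventually_elim (use contact[OF i True] True in \<open>simp add: mult_le_0_iff\<close>)
    next
      case False
      have "((\<lambda>t. ?P i \<bullet> (?H *v ?P i) + t * (?P i \<bullet> (\<Delta> *v ?P i))) \<longlongrightarrow>
          ?P i \<bullet> (?H *v ?P i) + 0 * (?P i \<bullet> (\<Delta> *v ?P i))) (at_right 0)" by (intro tendsto_intros)
      then have "eventually (\<lambda>t. ?P i \<bullet> (?H *v ?P i) + t * (?P i \<bullet> (\<Delta> *v ?P i)) < real CARD('n) + 1) (at_right 0)"
        by (rule order_tendstoD) (use le False in simp)
      then show ?thesis by eventually_elim simp
    qed
  qed
  have le1: "eventually (\<lambda>t. (\<Prod>j\<in>UNIV. 1 + t * x j) \<le> 1) (at_right 0)"
    using ev1 ev2
  proof eventually_elim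
    case (elim t)
    have cong: "transpose L ** (?H + t *\<^sub>R \<Delta>) ** L = diag (\<lambda>j. 1 + t * x j)"
    proof -
      have "transpose L ** (?H + t *\<^sub>R \<Delta>) ** L = transpose L ** ?H ** L + t *\<^sub>R (transpose L ** \<Delta> ** L)"
        by (simp add: vec_eq_iff congruence_entry dot_add_matrix dot_scaleR_matrix)
      then show ?thesis unfolding L by (simp add: vec_eq_iff diag_def mat_def)
    qed
    have spd: "sym_pos_def (?H + t *\<^sub>R \<Delta>)"
      by (rule sym_pos_def_of_congruence_diag[OF _ L(1) cong])
        (use elim in \<open>auto simp: transpose_add transpose_scalar Hsym sym\<close>)
    have "det (?H + t *\<^sub>R \<Delta>) \<le> det ?H"
    proof (rule lift_optimal[OF min _ spd])
      show "K \<subseteq> ellipsoid c' Q'" if "sym_pos_def Q'" "\<forall>i\<in>I. p i \<in> ellipsoid c' Q'" for c' Q'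
        using gen that by blast
      show "?P i \<bullet> ((?H + t *\<^sub>R \<Delta>) *v ?P i) \<le> real CARD('n) + 1" if "i \<in> I" for i
        using elim that by (simp add: dot_add_matrix dot_scaleR_matrix)
    qed
    then have "(det L)\<^sup>2 * det (?H + t *\<^sub>R \<Delta>) \<le> (det L)\<^sup>2 * det ?H" by (intro mult_left_mono) auto
    then show ?case unfolding det_congruence[symmetric] cong L(2) by (simp add: det_diag)
  qed
  \<comment> \<open>The determinant ratio along the step has derivative equal to the sum of the
    \<open>x j\<close> at 0.\<close>
  have "((\<lambda>t. \<Prod>j\<in>UNIV. 1 + t * x j) has_real_derivative
      (\<Sum>j\<in>UNIV. x j * (\<Prod>k\<in>UNIV - {j}. 1 + 0 * x k))) (at 0)"
    by (rule has_field_derivative_prod) (auto intro!: derivative_eq_intros)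
  then obtain d where d: "d > 0" "\<And>h. 0 < h \<Longrightarrow> h < d \<Longrightarrow> 1 < (\<Prod>j\<in>UNIV. 1 + h * x j)"
    using neg DERIV_pos_inc_right[of "\<lambda>t. \<Prod>j\<in>UNIV. 1 + t * x j"] by force
  have "eventually (\<lambda>t. t < d) (at_right 0)" using d(1) by (rule eventually_at_right_real[THEN eventually_mono]) auto
  with le1 eventually_at_right_less[of 0] have "eventually (\<lambda>t::real. False) (at_right 0)"
    by eventually_elim (use d in force)
  then show False by simp
qed

section \<open>Relative traces and the determinant comparison\<close>

lemma trace_diag: "trace (diag l) = (\<Sum>i\<in>UNIV. l i)"
  by (simp add: trace_def diag_def)

text \<open>Makes the trace relative to a form independent of the basis:
  \<open>L ** transpose L\<close> is the inverse of the form for every \<open>L\<close> that turns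
  it into the identity.\<close>

lemma trace_congruence:
  fixes A L :: "real^'m^'m"
  shows "trace (transpose L ** A ** L) = trace (A ** (L ** transpose L))"
  by (metis matrix_mul_assoc trace_mul_sym)

lemma congruence_left_inverse:
  fixes A L :: "real^'m^'m"
  assumes "transpose L ** A ** L = mat 1"
  shows "(L ** transpose L) ** A = mat 1"
proof -
  have "L ** (transpose L ** A) = mat 1" using assms matrix_left_right_inverse by blast
  then show ?thesis by (simp add: matrix_mul_assoc)
qed

lemma left_inverse_unique:
  fixes A X Y :: "real^'m^'m"
  assumes "X ** A = mat 1" "Y ** A = mat 1"
  shows "X = Y"
proof -
  have "A ** Y = mat 1" using assms(2) matrix_left_right_inverse by blast
  then have "X = (X ** A) ** Y" by (simp add: matrix_mul_assoc[symmetric])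
  then show ?thesis by (simp add: assms(1))
qed

text \<open>Only the \<open>None\<close> row and column of \<open>R\<close> enter, and both are read
  off from its value at \<open>lvec 1 0\<close>. It is applied to the inverse of
  \<open>lift c Q\<close>.\<close>

lemma trace_block_offdiag:
  fixes R :: "real^('n::finite option)^('n option)"
  assumes "transpose R = R" "R *v lvec 1 0 = lvec 1 c"
  shows "trace (block 0 d d 0 ** R) = 2 * (c \<bullet> d)"
proof -
  have col: "R $ Some j $ None = c $ j" for j
    using arg_cong[OF assms(2), of "\<lambda>v. v $ Some j"] by (simp add: matrix_vector_mult_def sum_UNIV_option)
  moreover have "R $ None $ Some j = c $ j" for j
    using arg_cong[OF assms(1), of "\<lambda>A. A $ Some j $ None"] col by (simp add: transpose_def)
  ultimately show ?thesis
    by (simp add: trace_def matrix_matrix_mult_def sum_UNIV_option inner_vec_def mult.commute)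
qed

text \<open>The tangent of \<open>ln\<close> at \<open>s^2\<close> bounds each logarithm by a linear
  function of \<open>l j\<close>, which reduces the sum to the assumed bound;
  \<open>ln s \<le> s - 1\<close> finishes.\<close>

lemma weighted_ln_le:
  fixes l u :: "'m::finite \<Rightarrow> real"
  assumes l: "\<And>j. l j > 0" and s: "s > 0" and u: "(\<Sum>j\<in>UNIV. (u j)\<^sup>2) = N"
    and le: "(\<Sum>j\<in>UNIV. l j * (u j)\<^sup>2) \<le> N * s\<^sup>2"
  shows "(\<Sum>j\<in>UNIV. ln (l j) * (u j)\<^sup>2) \<le> 2 * N * (s - 1)"
proof -
  have N: "N \<ge> 0" unfolding u[symmetric] by (intro sum_nonneg) auto
  have "ln (l j) \<le> l j / s\<^sup>2 + (2 * ln s - 1)" for j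
  proof -
    have "ln (l j / s\<^sup>2) \<le> l j / s\<^sup>2 - 1" using l[of j] s by (intro ln_le_minus_one) auto
    then show ?thesis using l[of j] s by (simp add: ln_div ln_realpow)
  qed
  then have "(\<Sum>j\<in>UNIV. ln (l j) * (u j)\<^sup>2) \<le> (\<Sum>j\<in>UNIV. (l j / s\<^sup>2 + (2 * ln s - 1)) * (u j)\<^sup>2)"
    by (intro sum_mono mult_right_mono) auto
  also have "\<dots> = (\<Sum>j\<in>UNIV. l j * (u j)\<^sup>2) / s\<^sup>2 + (2 * ln s - 1) * N"
    by (simp add: distrib_right sum.distrib sum_divide_distrib sum_distrib_left u[symmetric])
  also have "\<dots> \<le> N + (2 * ln s - 1) * N"
    using le s by (intro add_right_mono) (simp add: pos_divide_le_eq)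
  also have "\<dots> = 2 * N * ln s" by (simp add: algebra_simps)
  also have "\<dots> \<le> 2 * N * (s - 1)"
    using N s by (intro mult_left_mono ln_le_minus_one) auto
  finally show ?thesis .
qed

text \<open>The second ellipsoid is pulled back along the projective map \<open>y \<mapsto> y / (1 + y \<bullet> d)\<close>,
  which in the lift is the unimodular shear \<open>(s, y) \<mapsto> (s + d \<bullet> y, y)\<close>. The direction
  tested for first-order optimality is the logarithm of the pulled-back form relative to the
  optimal one, corrected by the linearization of \<open>2 ln (1 + y \<bullet> d)\<close>.\<close>

lemma ln_det_projective_le:
  fixes Q Qs :: "real^'n^'n" and p :: "'i \<Rightarrow> real^'n" and d cs :: "real^'n"
  assumes min: "is_min_CE K c Q" and I: "finite I" and pK: "\<And>i. i \<in> I \<Longrightarrow> p i \<in> K"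
    and gen: "\<And>c' Q'. sym_pos_def Q' \<Longrightarrow> (\<forall>i\<in>I. p i \<in> ellipsoid c' Q') \<Longrightarrow> K \<subseteq> ellipsoid c' Q'"
    and Qs: "sym_pos_def Qs" and s: "\<And>i. i \<in> I \<Longrightarrow> 1 + d \<bullet> p i > 0"
    and ps: "\<And>i. i \<in> I \<Longrightarrow> (p i - (1 + d \<bullet> p i) *\<^sub>R cs) \<bullet> (Qs *v (p i - (1 + d \<bullet> p i) *\<^sub>R cs)) \<le> (1 + d \<bullet> p i)\<^sup>2"
  shows "ln (det Qs) - ln (det Q) \<le> 2 * (real CARD('n) + 1) * (c \<bullet> d)"
proof -
  let ?H = "lift c Q" and ?Hs = "lift cs Qs" and ?n = "real CARD('n)"
  define T :: "real^('n option)^('n option)" where "T = block 1 d 0 (mat 1)"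
  define H' where "H' = transpose T ** ?Hs ** T"
  have Q: "sym_pos_def Q" using min by (simp add: is_min_CE_def)
  have Qsym: "transpose Q = Q" "transpose Qs = Qs" using Q Qs by (auto simp: sym_pos_def_def)
  note H = sym_pos_def_lift[OF Q, of c] and Hs = sym_pos_def_lift[OF Qs, of cs]
  have Hsym: "transpose ?H = ?H" "transpose ?Hs = ?Hs" using H Hs by (auto simp: sym_pos_def_def)
  have Tl: "T *v lvec t y = lvec (t + d \<bullet> y) y" for t y by (simp add: T_def block_mult_lvec)
  have H'dot: "x \<bullet> (H' *v x) = (T *v x) \<bullet> (?Hs *v (T *v x))" for x
    unfolding H'_def by (rule dot_congruence)
  have H'sym: "transpose H' = H'" by (simp add: H'_def matrix_transpose_mul Hsym matrix_mul_assoc)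
  have H': "sym_pos_def H'" unfolding sym_pos_def_def
  proof (intro conjI H'sym allI impI)
    fix x :: "real^('n option)" assume "x \<noteq> 0"
    obtain t y where x: "x = lvec t y" by (rule lvec_cases)
    have "T *v x \<noteq> 0" using \<open>x \<noteq> 0\<close> by (auto simp: x Tl lvec_eq_0_iff)
    then show "0 < x \<bullet> (H' *v x)" unfolding H'dot using Hs by (simp add: sym_pos_def_def)
  qed
  have "det T = 1" by (simp add: T_def det_block_upper)
  then have detH': "det H' = det ?Hs" by (simp add: H'_def det_congruence)
  obtain L :: "real^('n option)^('n option)" and l where
    L: "invertible L" "transpose L ** ?H ** L = mat 1" "transpose L ** H' ** L = diag l"
    using simultaneous_diagonalization[OF H H'sym] .
  have l: "l j > 0" for j by (rule diag_entry_pos[OF H' L(1,3)])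
  obtain M where M: "L ** M = mat 1" "M ** L = mat 1" using L(1) by (auto simp: invertible_def)
  define \<Delta>0 where "\<Delta>0 = transpose M ** diag (\<lambda>j. ln (l j)) ** M"
  \<comment> \<open>At \<open>lvec 1 (p i)\<close> the correction subtracts
    \<open>2 * (n + 1) * (d \<bullet> p i)\<close>, exactly the bound that
    \<open>weighted_ln_le\<close> gives at contact points.\<close>
  define \<Delta> where "\<Delta> = \<Delta>0 - (?n + 1) *\<^sub>R block 0 d d 0"
  have \<Delta>_dot: "x \<bullet> (\<Delta> *v x) = x \<bullet> (\<Delta>0 *v x) - (?n + 1) * (x \<bullet> (block 0 d d 0 *v x))" for x
    by (simp add: \<Delta>_def matrix_vector_mult_diff_rdistrib inner_diff_right dot_scaleR_matrix)
  have "transpose (diag f) = diag f" for f :: "'n option \<Rightarrow> real" by (simp add: vec_eq_iff transpose_def diag_def)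
  then have "transpose \<Delta>0 = \<Delta>0" by (simp add: \<Delta>0_def matrix_transpose_mul matrix_mul_assoc)
  moreover have "transpose (block 0 d d 0) = block 0 d d (0 :: real^'n^'n)"
  proof -
    have "transpose (0 :: real^'n^'n) = 0" by (simp add: transpose_def vec_eq_iff)
    then show ?thesis by (simp add: transpose_block)
  qed
  ultimately have \<Delta>sym: "transpose \<Delta> = \<Delta>"
    by (simp add: \<Delta>_def transpose_def vec_eq_iff)
  have contact: "lvec 1 (p i) \<bullet> (\<Delta> *v lvec 1 (p i)) \<le> 0"
    if i: "i \<in> I" and c: "lvec 1 (p i) \<bullet> (?H *v lvec 1 (p i)) = ?n + 1" for i
  proof -
    let ?P = "lvec 1 (p i)" and ?s = "1 + d \<bullet> p i"
    \<comment> \<open>Coordinates in the basis orthonormal for \<open>lift c Q\<close>, so at a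
      contact point their squares sum to \<open>n + 1\<close>.\<close>
    define u where "u = M *v ?P"
    have P: "?P = L *v u" by (simp add: u_def matrix_vector_mul_assoc M)
    have "(\<Sum>j\<in>UNIV. (u $ j)\<^sup>2) = ?n + 1"
      using c unfolding P dot_congruence[symmetric] L(2) by (simp add: inner_vec_def power2_eq_square)
    moreover have "(\<Sum>j\<in>UNIV. l j * (u $ j)\<^sup>2) \<le> (?n + 1) * ?s\<^sup>2"
    proof -
      have "?P \<bullet> (H' *v ?P) = ?s\<^sup>2 + ?n * ((p i - ?s *\<^sub>R cs) \<bullet> (Qs *v (p i - ?s *\<^sub>R cs)))"
        unfolding H'dot Tl by (rule lift_dot[OF Qsym(2)])
      also have "\<dots> \<le> ?s\<^sup>2 + ?n * ?s\<^sup>2" using ps[OF i] by (intro add_left_mono mult_left_mono) auto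
      also have "\<dots> = (?n + 1) * ?s\<^sup>2" by (simp add: algebra_simps)
      finally show ?thesis unfolding P dot_congruence[symmetric] L(3) dot_diag .
    qed
    ultimately have "(\<Sum>j\<in>UNIV. ln (l j) * (u $ j)\<^sup>2) \<le> 2 * (?n + 1) * (?s - 1)"
      using weighted_ln_le[of l ?s "\<lambda>j. u $ j" "?n + 1"] l s[OF i] by blast
    moreover have "?P \<bullet> (\<Delta>0 *v ?P) = (\<Sum>j\<in>UNIV. ln (l j) * (u $ j)\<^sup>2)"
      unfolding \<Delta>0_def dot_congruence u_def[symmetric] dot_diag ..
    moreover have "?P \<bullet> (block 0 d d 0 *v ?P) = 2 * (d \<bullet> p i)" by (simp add: block_dot)
    ultimately show ?thesis by (simp add: \<Delta>_dot algebra_simps)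
  qed
  \<comment> \<open>The correction need not be diagonal in the basis \<open>L\<close>, so
    \<open>\<Delta>\<close> gets its own basis; both sums are compared as traces against the common
    inverse \<open>R\<close>.\<close>
  obtain L2 :: "real^('n option)^('n option)" and x where
    L2: "invertible L2" "transpose L2 ** ?H ** L2 = mat 1" "transpose L2 ** \<Delta> ** L2 = diag x"
    using simultaneous_diagonalization[OF H \<Delta>sym] .
  have x: "(\<Sum>j\<in>UNIV. x j) \<le> 0"
    by (rule lift_first_order[OF min I pK gen \<Delta>sym contact L2])
  define R where "R = L ** transpose L"
  have RH: "R ** ?H = mat 1" unfolding R_def by (rule congruence_left_inverse[OF L(2)])
  have R2: "L2 ** transpose L2 = R" by (rule left_inverse_unique[OF congruence_left_inverse[OF L2(2)] RH])
  have Rc: "R *v lvec 1 0 = lvec 1 c"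
  proof -
    have "?H *v lvec 1 c = lvec 1 0"
      by (simp add: lift_def block_mult_lvec inner_commute scaleR_matrix_vector_assoc[symmetric])
    then show ?thesis by (metis RH matrix_vector_mul_assoc matrix_vector_mul_lid)
  qed
  have Rsym: "transpose R = R" by (simp add: R_def matrix_transpose_mul)
  have tr0: "trace (\<Delta>0 ** R) = (\<Sum>j\<in>UNIV. ln (l j))"
  proof -
    have "transpose L ** \<Delta>0 ** L = (transpose L ** transpose M) ** diag (\<lambda>j. ln (l j)) ** (M ** L)"
      by (simp add: \<Delta>0_def matrix_mul_assoc)
    also have "\<dots> = diag (\<lambda>j. ln (l j))"
      by (simp add: M matrix_transpose_mul[symmetric] transpose_mat)
    finally show ?thesis unfolding R_def by (metis trace_congruence trace_diag)
  qed
  have "(\<Sum>j\<in>UNIV. x j) = trace (\<Delta> ** R)" by (metis L2(3) R2 trace_congruence trace_diag)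
  also have "\<Delta> ** R = \<Delta>0 ** R - (?n + 1) *\<^sub>R (block 0 d d 0 ** R)"
    by (simp add: \<Delta>_def vec_eq_iff matrix_matrix_mult_def left_diff_distrib sum_subtractf sum_distrib_left mult.assoc)
  also have "trace \<dots> = (\<Sum>j\<in>UNIV. ln (l j)) - (?n + 1) * (2 * (c \<bullet> d))"
    using trace_block_offdiag[OF Rsym Rc, of d]
    by (simp add: trace_sub tr0) (simp add: trace_def sum_distrib_left[symmetric])
  finally have sum_le: "(\<Sum>j\<in>UNIV. ln (l j)) \<le> 2 * (?n + 1) * (c \<bullet> d)" using x by (simp add: algebra_simps)
  have dets: "det ?H > 0" "det ?Hs > 0" "det Q > 0" "det Qs > 0"
    using H Hs Q Qs by (auto intro: sym_pos_def_det_pos)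
  have "(\<Prod>j\<in>UNIV. l j) * det ?H = det ?Hs"
  proof -
    have one: "(det L)\<^sup>2 * det ?H = 1" by (metis L(2) det_congruence det_I)
    have "(det L)\<^sup>2 * det ?Hs = (\<Prod>j\<in>UNIV. l j)" by (metis L(3) detH' det_congruence det_diag)
    then have "(\<Prod>j\<in>UNIV. l j) * det ?H = ((det L)\<^sup>2 * det ?H) * det ?Hs" by (simp add: mult_ac)
    then show ?thesis unfolding one by simp
  qed
  then have "ln (\<Prod>j\<in>UNIV. l j) + ln (det ?H) = ln (det ?Hs)"
    using l dets by (metis ln_mult_pos prod_pos)
  moreover have "ln (\<Prod>j\<in>UNIV. l j) = (\<Sum>j\<in>UNIV. ln (l j))" by (rule ln_prod) (simp, metis l less_irrefl)
  moreover have "ln (det ?Hs) - ln (det ?H) = ln (det Qs) - ln (det Q)"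
    using dets(3,4) by (simp add: det_lift Qsym ln_mult_pos)
  ultimately show ?thesis using sum_le by linarith
qed

subsection \<open>Polars of polytopes\<close>

lemma convex_ellipsoid:
  fixes Q :: "real^'n^'n"
  assumes "sym_pos_def Q"
  shows "convex (ellipsoid c Q)"
proof (rule convexI)
  fix y z and u v :: real
  assume yz: "y \<in> ellipsoid c Q" "z \<in> ellipsoid c Q" and uv: "0 \<le> u" "0 \<le> v" "u + v = 1"
  have sym: "transpose Q = Q" using assms by (simp add: sym_pos_def_def)
  define y' z' where "y' = y - c" and "z' = z - c"
  let ?q = "\<lambda>x. x \<bullet> (Q *v x)"
  have le: "?q y' \<le> 1" "?q z' \<le> 1" using yz by (auto simp: ellipsoid_def y'_def z'_def)
  have nn: "0 \<le> ?q (z' - y')" using assms by (cases "z' - y' = 0") (auto simp: sym_pos_def_def less_imp_le)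
  have u: "u = 1 - v" using uv by simp
  have "?q (y' + v *\<^sub>R (z' - y')) = (1 - v) * ?q y' + v * ?q z' - v * (1 - v) * ?q (z' - y')"
    using quadratic_form_add[OF sym, of y' v "z' - y'"] quadratic_form_add[OF sym, of y' 1 "z' - y'"]
    by (simp add: algebra_simps power2_eq_square)
  also have "\<dots> \<le> (1 - v) * 1 + v * 1 - 0"
    using uv nn le by (intro diff_mono add_mono mult_left_mono mult_nonneg_nonneg) auto
  finally have "?q (y' + v *\<^sub>R (z' - y')) \<le> 1" by simp
  moreover have "u *\<^sub>R y + v *\<^sub>R z - c = y' + v *\<^sub>R (z' - y')" by (simp add: y'_def z'_def u algebra_simps)
  ultimately show "u *\<^sub>R y + v *\<^sub>R z \<in> ellipsoid c Q" by (simp add: ellipsoid_def)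
qed

text \<open>From an interior point a short step along \<open>a i\<close> stays in the polytope and
  increases \<open>a i \<bullet> x\<close>.\<close>

lemma interior_polytope_ineq_less:
  assumes "x \<in> interior (polytope_ineq m a)" "i \<in> {1..m}"
  shows "a i \<bullet> x < 1"
proof (cases "a i = 0")
  case False
  obtain e where e: "e > 0" "cball x e \<subseteq> polytope_ineq m a" using assms(1) mem_interior_cball by blast
  have "x + (e / norm (a i)) *\<^sub>R a i \<in> cball x e" using e False by (simp add: dist_norm)
  then have "x + (e / norm (a i)) *\<^sub>R a i \<in> polytope_ineq m a" using e by blast
  then have "a i \<bullet> x + (e / norm (a i)) * (a i \<bullet> a i) \<le> 1"
    using assms(2) by (auto simp: polytope_ineq_def inner_add_right)
  moreover have "(e / norm (a i)) * (a i \<bullet> a i) > 0" using e False by simp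
  ultimately show ?thesis by linarith
qed simp

lemma a_tilde_dot_le_iff:
  assumes "a i \<bullet> x < 1"
  shows "a_tilde a i x \<bullet> w \<le> 1 \<longleftrightarrow> a i \<bullet> (x + w) \<le> 1"
  using assms by (simp add: a_tilde_def inner_add_right field_simps)

lemma a_tilde_in_polar_at:
  assumes "x \<in> interior (polytope_ineq m a)" "i \<in> {1..m}"
  shows "a_tilde a i x \<in> polar_at (polytope_ineq m a) x"
  unfolding polar_at_def polar_set_def
  using a_tilde_dot_le_iff[where a = a and i = i, OF interior_polytope_ineq_less[OF assms]] assms(2)
  by (auto simp: polytope_ineq_def)

text \<open>A hyperplane separating \<open>y\<close> from the hull gives a direction
  \<open>- g\<close>. Depending on the sign of its level, it rescales to a point of \<open>P\<close>
  violating the polar inequality of \<open>y\<close>, or spans a ray inside the bounded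
  \<open>P\<close>.\<close>

lemma polar_at_subset_convex_hull:
  assumes bdd: "bounded (polytope_ineq m a)" and x: "x \<in> interior (polytope_ineq m a)"
  shows "polar_at (polytope_ineq m a) x \<subseteq> convex hull ((\<lambda>i. a_tilde a i x) ` {1..m})"
proof
  let ?P = "polytope_ineq m a" and ?C = "convex hull ((\<lambda>i. a_tilde a i x) ` {1..m})"
  fix y assume y: "y \<in> polar_at ?P x"
  note ax = interior_polytope_ineq_less[OF x]
  have m: "m \<noteq> 0"
  proof
    assume "m = 0"
    then have "?P = UNIV" by (simp add: polytope_ineq_def)
    then show False using bdd not_bounded_UNIV by simp
  qed
  show "y \<in> ?C"
  proof (rule ccontr)
    assume "y \<notin> ?C"
    moreover have "closed ?C" by (intro compact_imp_closed finite_imp_compact_convex_hull) simp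
    ultimately obtain g b where g: "g \<bullet> y < b" "\<forall>z\<in>?C. b < g \<bullet> z"
      using separating_hyperplane_closed_point[of ?C y] convex_convex_hull by blast
    have gi: "a_tilde a i x \<bullet> (- g) < - b" if "i \<in> {1..m}" for i
      using g(2) that hull_inc[of "a_tilde a i x" "(\<lambda>i. a_tilde a i x) ` {1..m}" convex] by (auto simp: inner_commute)
    show False
    proof (cases "- b > 0")
      case True
      define w where "w = (1 / - b) *\<^sub>R (- g)"
      have "a i \<bullet> (x + w) \<le> 1" if "i \<in> {1..m}" for i
        using gi[OF that] True a_tilde_dot_le_iff[where a = a and i = i, OF ax[OF that], of w] by (simp add: w_def field_simps)
      then have "x + w \<in> ?P" by (simp add: polytope_ineq_def)
      then have "y \<bullet> w \<le> 1" using y unfolding polar_at_def polar_set_def by force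
      moreover have "y \<bullet> w > 1" using g(1) True by (simp add: w_def inner_commute field_simps)
      ultimately show False by simp
    next
      case False
      have ag: "a i \<bullet> (- g) < 0" if "i \<in> {1..m}" for i
      proof -
        have "(1 / (1 - a i \<bullet> x)) * (a i \<bullet> (- g)) < 0" using gi[OF that] False by (simp add: a_tilde_def)
        moreover have "1 / (1 - a i \<bullet> x) > 0" using ax[OF that] by simp
        ultimately show ?thesis by (meson mult_less_0_iff order_less_asym)
      qed
      have "g \<noteq> 0" using ag[of 1] m by auto
      have ray: "x + t *\<^sub>R (- g) \<in> ?P" if "t \<ge> 0" for t
        unfolding polytope_ineq_def
      proof clarify
        fix i assume i: "i \<in> {1..m}"
        have "t * (a i \<bullet> (- g)) \<le> 0" using ag[OF i] that by (simp add: mult_le_0_iff)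
        then show "a i \<bullet> (x + t *\<^sub>R (- g)) \<le> 1" using ax[OF i] by (simp add: inner_add_right inner_diff_right)
      qed
      obtain B where B: "\<And>z. z \<in> ?P \<Longrightarrow> norm z \<le> B" using bdd by (auto simp: bounded_iff)
      \<comment> \<open>Far enough along the ray that the norm bound \<open>B\<close> fails by
        1.\<close>
      define t where "t = (B + norm x + 1) / norm g"
      have "B \<ge> 0" using B[of x] ray[of 0] norm_ge_zero[of x] by (simp, linarith)
      then have t: "t \<ge> 0" "norm (t *\<^sub>R g) = B + norm x + 1" using \<open>g \<noteq> 0\<close> by (auto simp: t_def)
      have "norm (t *\<^sub>R g) \<le> norm x + norm (x + t *\<^sub>R (- g))"
        using norm_triangle_ineq4[of x "x + t *\<^sub>R (- g)"] by simp
      also have "\<dots> \<le> norm x + B" using B[OF ray[OF t(1)]] by simp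
      finally show False using t(2) by simp
    qed
  qed
qed

text \<open>Supplies the hypothesis \<open>gen\<close> of the lift lemmas: ellipsoids are convex, so
  the finitely many generators decide containment.\<close>

lemma polar_at_subset_ellipsoid:
  assumes "bounded (polytope_ineq m a)" "x \<in> interior (polytope_ineq m a)"
    and "sym_pos_def Q" "\<forall>i\<in>{1..m}. a_tilde a i x \<in> ellipsoid c Q"
  shows "polar_at (polytope_ineq m a) x \<subseteq> ellipsoid c Q"
  using polar_at_subset_convex_hull[OF assms(1,2)] hull_minimal[of _ "ellipsoid c Q" convex] convex_ellipsoid[OF assms(3)] assms(4)
  by (meson image_subsetI order_trans)

text \<open>Differences of points of \<open>P\<close> have norm at most \<open>2 * R\<close>. The
  radius does not depend on \<open>x\<close>, which later makes \<open>\<sigma>\<close>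
  uniform.\<close>

lemma cball_subset_polar_at:
  fixes P :: "(real^'n) set"
  assumes "P \<subseteq> cball 0 R" "R > 0" "x \<in> P"
  shows "cball 0 (1 / (2 * R)) \<subseteq> polar_at P x"
  unfolding polar_at_def polar_set_def
proof clarify
  fix u y :: "real^'n" assume u: "u \<in> cball 0 (1 / (2 * R))" and y: "y \<in> P"
  have "norm y \<le> R" "norm x \<le> R" using assms(1,3) y by auto
  then have "norm (y - x) \<le> 2 * R" using norm_triangle_ineq4[of y x] by linarith
  moreover have "norm u \<le> 1 / (2 * R)" using u by simp
  ultimately have "norm u * norm (y - x) \<le> 1 / (2 * R) * (2 * R)" using assms(2) by (intro mult_mono) auto
  then show "u \<bullet> (y - x) \<le> 1" using norm_cauchy_schwarz[of u "y - x"] assms(2) by simp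
qed

lemma is_min_CE_polar_at:
  assumes "bounded (polytope_ineq m a)" "x \<in> interior (polytope_ineq m a)"
  shows "is_min_CE (polar_at (polytope_ineq m a) x) (cpol (polytope_ineq m a) x) (Qpol (polytope_ineq m a) x)"
proof -
  obtain R where R: "R > 0" "polytope_ineq m a \<subseteq> cball 0 R"
    using assms(1) by (auto simp: bounded_pos subset_iff)
  have "bounded (polar_at (polytope_ineq m a) x)"
    by (rule bounded_subset[OF _ polar_at_subset_convex_hull[OF assms]]) (simp add: finite_imp_bounded_convex_hull)
  then show ?thesis unfolding cpol_def Qpol_def
    using R cball_subset_polar_at[OF R(2,1)] interior_subset assms(2)
    by (intro is_min_CE_min_CE[of _ "1 / (2 * R)"]) auto
qed

section \<open>Assembling the bound near the center\<close>

theorem proposition3: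
  fixes a :: "nat \<Rightarrow> real ^ 'n" and m :: nat
    and P U_QG U_shift :: "(real ^ 'n) set"
    and xs :: "real ^ 'n" and \<mu> \<beta> r :: real
  assumes P_eq: "P = polytope_ineq m a"
    and P_bounded: "bounded P"
    and P_full_dim: "interior P \<noteq> {}"
    and xs_center: "xs = fst (max_IE P)"
    and U_QG_ball: "r > 0" "U_QG = ball xs r"
    and U_QG_sub: "U_QG \<subseteq> interior P"
    and mu_pos: "\<mu> > 0"
    and quadratic_growth:
      "\<forall>x\<in>U_QG. vpol P x - vpol P xs \<ge> \<mu> * (norm (x - xs))\<^sup>2"
    and U_shift_nbhd: "open U_shift" "xs \<in> U_shift"
    and U_shift_sub: "U_shift \<subseteq> interior P"
    and beta_pos: "\<beta> > 0"
    and shift: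
      "\<forall>x\<in>U_shift. \<forall>i\<in>{1..m}.
         (a_tilde a i x - c_bar P xs x) \<bullet> (Qpol P xs *v (a_tilde a i x - c_bar P xs x))
           \<le> 1 + \<beta> * (norm (x - xs))\<^sup>2"
  shows "\<exists>U_PL \<sigma>. open U_PL \<and> xs \<in> U_PL \<and> U_PL \<subseteq> U_QG \<inter> U_shift \<and> \<sigma> > 0 \<and>
    (\<forall>x\<in>U_PL. vpol P x - vpol P xs
       \<le> \<beta> * real CARD('n) * (real CARD('n) + 1)\<^sup>2 / (2 * \<sigma> * \<mu>\<^sup>2) * tau P x)"
proof -
  let ?n = "real CARD('n)"
  note bdd = P_bounded[unfolded P_eq]
  have min: "is_min_CE (polar_at P x) (cpol P x) (Qpol P x)" if "x \<in> interior P" for x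
    using is_min_CE_polar_at[OF bdd] that unfolding P_eq .
  have spd: "sym_pos_def (Qpol P x)" if "x \<in> interior P" for x using min[OF that] by (simp add: is_min_CE_def)
  note det_pos = sym_pos_def_det_pos[OF spd]
  have v: "vpol P x = - ln (det (Qpol P x)) / 2" if "x \<in> interior P" for x
    using ln_ellipsoid_vol[OF det_pos[OF that]] by (simp add: vpol_def)
  have less: "a i \<bullet> x < 1" if "x \<in> interior P" "i \<in> {1..m}" for x i
    using interior_polytope_ineq_less that unfolding P_eq by blast
  have xs: "xs \<in> interior P" using U_shift_nbhd U_shift_sub by blast
  obtain R where R: "R > 0" "P \<subseteq> cball 0 R"
    using P_bounded by (auto simp: bounded_pos subset_iff)
  define \<rho> where "\<rho> = 1 / (2 * R)"
  have \<rho>: "\<rho> > 0" using R by (simp add: \<rho>_def)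
  \<comment> \<open>A lower bound for \<open>det (Qpol P x)\<close>: the shifted ellipsoid is a
    competitor, and \<open>norm (x - xs) < r\<close> bounds its scaling factor.\<close>
  define D where "D = (1 / (1 + \<beta> * r\<^sup>2)) ^ CARD('n) * det (Qpol P xs)"
  define \<sigma> where "\<sigma> = D * \<rho> ^ (2 * (CARD('n) - 1))"
  have D: "D > 0" using det_pos[OF xs] beta_pos unfolding D_def by (intro mult_pos_pos zero_less_power) (auto intro: add_pos_nonneg)
  have \<sigma>: "\<sigma> > 0" using D \<rho> by (simp add: \<sigma>_def)
  \<comment> \<open>The neighborhood is all of \<open>U_QG \<inter> U_shift\<close>, because
    \<open>\<sigma>\<close> works throughout it.\<close>
  have "vpol P x - vpol P xs \<le> \<beta> * ?n * (?n + 1)\<^sup>2 / (2 * \<sigma> * \<mu>\<^sup>2) * tau P x"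
    if x: "x \<in> U_QG \<inter> U_shift" for x
  proof -
    define d where "d = x - xs"
    define \<kappa> where "\<kappa> = 1 + \<beta> * (norm d)\<^sup>2"
    let ?Q = "Qpol P x" and ?Qs = "Qpol P xs" and ?c = "cpol P x"
    have xP: "x \<in> interior P" using x U_QG_sub by blast
    have \<kappa>: "\<kappa> > 0" using beta_pos by (auto simp: \<kappa>_def intro: add_pos_nonneg)
    have "?c \<bullet> d * (?n + 1) \<ge> vpol P x - vpol P xs"
    proof -
      have "ln (det ?Qs) - ln (det ?Q) \<le> 2 * (?n + 1) * (?c \<bullet> d)"
      proof (rule ln_det_projective_le[OF min[OF xP], where I = "{1..m}" and p = "\<lambda>i. a_tilde a i x" and cs = "cpol P xs"])
        show "a_tilde a i x \<in> polar_at P x" if "i \<in> {1..m}" for i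
          using a_tilde_in_polar_at xP that unfolding P_eq by blast
        show "polar_at P x \<subseteq> ellipsoid c' Q'" if "sym_pos_def Q'" "\<forall>i\<in>{1..m}. a_tilde a i x \<in> ellipsoid c' Q'" for c' Q'
          using polar_at_subset_ellipsoid[OF bdd] xP that unfolding P_eq by blast
        show "sym_pos_def ?Qs" by (rule spd[OF xs])
        fix i assume i: "i \<in> {1..m}"
        note lx = less[OF xP i] and lxs = less[OF xs i]
        let ?s = "1 + d \<bullet> a_tilde a i x"
        \<comment> \<open>The factor \<open>?s\<close> relates the generators at the two base
          points: \<open>a_tilde a i x\<close> is \<open>?s\<close> times
          \<open>a_tilde a i xs\<close>.\<close>
        have "d \<bullet> a i = a i \<bullet> x - a i \<bullet> xs" by (metis d_def inner_commute inner_diff_right)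
        then have s: "?s = (1 - a i \<bullet> xs) / (1 - a i \<bullet> x)"
          using lx by (simp add: a_tilde_def field_simps)
        then show s_pos: "?s > 0" using lx lxs by simp
        have "a_tilde a i x = ?s *\<^sub>R a_tilde a i xs" unfolding s using lx lxs by (simp add: a_tilde_def)
        then have diff: "a_tilde a i x - ?s *\<^sub>R cpol P xs = ?s *\<^sub>R (a_tilde a i xs - cpol P xs)"
          by (metis scaleR_right_diff_distrib)
        have "a_tilde a i xs \<in> ellipsoid (cpol P xs) ?Qs"
          using a_tilde_in_polar_at[of xs m a i] xs i min[OF xs] unfolding P_eq is_min_CE_def by blast
        then have "(a_tilde a i xs - cpol P xs) \<bullet> (?Qs *v (a_tilde a i xs - cpol P xs)) \<le> 1"
          by (simp add: ellipsoid_def)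
        then have "?s\<^sup>2 * ((a_tilde a i xs - cpol P xs) \<bullet> (?Qs *v (a_tilde a i xs - cpol P xs))) \<le> ?s\<^sup>2 * 1"
          by (intro mult_left_mono) auto
        then show "(a_tilde a i x - ?s *\<^sub>R cpol P xs) \<bullet> (?Qs *v (a_tilde a i x - ?s *\<^sub>R cpol P xs)) \<le> ?s\<^sup>2"
          unfolding diff by (simp add: matrix_vector_mult_scaleR power2_eq_square mult.assoc)
      qed simp
      then show ?thesis unfolding v[OF xP] v[OF xs] by (simp add: field_simps)
    qed
    then have "\<mu> * (norm d)\<^sup>2 \<le> ?c \<bullet> d * (?n + 1)"
      using quadratic_growth x unfolding d_def by force
    also have "\<dots> \<le> norm ?c * norm d * (?n + 1)"
      by (intro mult_right_mono norm_cauchy_schwarz) simp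
    finally have "\<mu> * norm d * norm d \<le> norm ?c * (?n + 1) * norm d" by (simp add: power2_eq_square mult_ac)
    then have "\<mu> * norm d \<le> norm ?c * (?n + 1)"
      by (cases "d = 0") auto
    then have "(\<mu> * norm d)\<^sup>2 \<le> (norm ?c * (?n + 1))\<^sup>2"
      using mu_pos by (intro power_mono) auto
    then have d_le: "\<mu>\<^sup>2 * (norm d)\<^sup>2 \<le> (?n + 1)\<^sup>2 * (?c \<bullet> ?c)"
      by (simp add: power_mult_distrib power2_norm_eq_inner mult.commute)
    \<comment> \<open>Minimality of \<open>Qpol P x\<close> against the shifted ellipsoid gives the
      upper bound on the growth of \<open>vpol\<close>.\<close>
    have "polar_at P x \<subseteq> ellipsoid (c_bar P xs x) ((1 / \<kappa>) *\<^sub>R ?Qs)"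
      unfolding P_eq
    proof (rule polar_at_subset_ellipsoid[OF bdd])
      show "x \<in> interior (polytope_ineq m a)" using xP unfolding P_eq .
      show "sym_pos_def ((1 / \<kappa>) *\<^sub>R Qpol (polytope_ineq m a) xs)"
        using sym_pos_def_scaleR[OF spd[OF xs], of "1 / \<kappa>"] \<kappa> unfolding P_eq by simp
      show "\<forall>i\<in>{1..m}. a_tilde a i x \<in> ellipsoid (c_bar (polytope_ineq m a) xs x) ((1 / \<kappa>) *\<^sub>R Qpol (polytope_ineq m a) xs)"
        using shift x \<kappa> unfolding P_eq[symmetric] by (simp add: ellipsoid_def dot_scaleR_matrix \<kappa>_def d_def)
    qed
    moreover have "sym_pos_def ((1 / \<kappa>) *\<^sub>R ?Qs)" using \<kappa> by (intro sym_pos_def_scaleR spd xs) simp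
    ultimately have "det ((1 / \<kappa>) *\<^sub>R ?Qs) \<le> det ?Q" using min[OF xP] unfolding is_min_CE_iff_det by blast
    then have det_le: "(1 / \<kappa>) ^ CARD('n) * det ?Qs \<le> det ?Q" by (simp add: det_scaleR)
    have "ln ((1 / \<kappa>) ^ CARD('n) * det ?Qs) \<le> ln (det ?Q)"
      using det_le det_pos[OF xP] det_pos[OF xs] \<kappa> by (subst ln_le_cancel_iff) auto
    then have "ln (det ?Qs) - ln (det ?Q) \<le> ?n * ln \<kappa>"
      using det_pos[OF xs] \<kappa> by (simp add: ln_mult_pos ln_realpow ln_div)
    also have "\<dots> \<le> ?n * (\<kappa> - 1)" using \<kappa> by (intro mult_left_mono ln_le_minus_one) auto
    finally have v_le: "vpol P x - vpol P xs \<le> ?n * \<beta> / 2 * (norm d)\<^sup>2"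
      unfolding v[OF xP] v[OF xs] by (simp add: \<kappa>_def)
    have c_le: "?c \<bullet> ?c \<le> tau P x / \<sigma>"
    proof -
      have "norm d < r" using x unfolding U_QG_ball d_def by (simp add: dist_norm norm_minus_commute)
      then have "(norm d)\<^sup>2 \<le> r\<^sup>2" by (intro power_mono) auto
      then have "\<kappa> \<le> 1 + \<beta> * r\<^sup>2" using beta_pos by (simp add: \<kappa>_def)
      then have "1 / (1 + \<beta> * r\<^sup>2) \<le> 1 / \<kappa>" using \<kappa> by (intro divide_left_mono mult_pos_pos) auto
      then have "D \<le> (1 / \<kappa>) ^ CARD('n) * det ?Qs"
        unfolding D_def using det_pos[OF xs] beta_pos by (intro mult_right_mono power_mono) (auto intro!: add_nonneg_nonneg)
      then have Dle: "D \<le> det ?Q" using det_le by simp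
      have "x \<in> P" using xP interior_subset by blast
      then have sub: "cball 0 \<rho> \<subseteq> ellipsoid ?c ?Q"
        using cball_subset_polar_at[OF R(2,1)] min[OF xP] unfolding \<rho>_def is_min_CE_def by blast
      have "\<sigma> * (?c \<bullet> ?c) \<le> tau P x" unfolding \<sigma>_def tau_def
      proof (rule ellipsoid_cball_bounds(3)[OF _ _ sub \<rho> Dle])
        show "transpose ?Q = ?Q" using spd[OF xP] by (simp add: sym_pos_def_def)
        show "0 \<le> y \<bullet> (?Q *v y)" for y
          using spd[OF xP] by (cases "y = 0") (auto simp: sym_pos_def_def less_imp_le)
      qed
      then show ?thesis using \<sigma> by (simp add: field_simps)
    qed
    \<comment> \<open>Chain of the three estimates: \<open>vpol\<close> by the distance, the
      distance by the norm of \<open>?c\<close>, that norm by \<open>tau\<close>.\<close>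
    note v_le
    also have "?n * \<beta> / 2 * (norm d)\<^sup>2 = ?n * \<beta> / (2 * \<mu>\<^sup>2) * (\<mu>\<^sup>2 * (norm d)\<^sup>2)" using mu_pos by simp
    also have "\<dots> \<le> ?n * \<beta> / (2 * \<mu>\<^sup>2) * ((?n + 1)\<^sup>2 * (?c \<bullet> ?c))"
      using d_le beta_pos by (intro mult_left_mono) auto
    also have "\<dots> \<le> ?n * \<beta> / (2 * \<mu>\<^sup>2) * ((?n + 1)\<^sup>2 * (tau P x / \<sigma>))"
      using c_le beta_pos by (intro mult_left_mono) auto
    also have "\<dots> = \<beta> * ?n * (?n + 1)\<^sup>2 / (2 * \<sigma> * \<mu>\<^sup>2) * tau P x" by (simp add: ac_simps)
    finally show ?thesis .
  qed
  moreover have "open (U_QG \<inter> U_shift)" using U_shift_nbhd U_QG_ball by (intro open_Int) auto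
  moreover have "xs \<in> U_QG \<inter> U_shift" using U_shift_nbhd U_QG_ball by auto
  ultimately show ?thesis using \<sigma> by blast
qed

end
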